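(* A countable topological group is metrizable if and only if its topology is sequential, analytic, and has sequential order less than $\omega_1$.
   Context: All topological spaces are assumed to be regular (including Hausdorff). The topology of a countable space $X$ is called analytic if, viewed as a subset of $2^X$ with the product topology, it is a continuous image of the irrationals $\mathbb{N}^\omega$. A space $X$ is sequential if whenever $A\subseteq X$ and $\overline{A}\setminus A\neq\varnothing$, there is a sequence of points of $A$ converging to some $x\in\overline{A}\setminus A$. For $A\subseteq X$ let $[A]'$ be the set of all limits of convergent sequences of points of $A$; put $[A]_0=A$, $[A]_{\alpha+1}=[[A]_\alpha]'$, and $[A]_\alpha=\bigcup_{\beta<\alpha}[A]_\beta$ for limit $\alpha$. The sequential order of a sequential space $X$ is the smallest ordinal $\gamma\le\omega_1$ such that $\overline{A}=[A]_\gamma$ for every $A\subseteq X$. *)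

theory Defs
  imports "HOL-Analysis.Analysis"
begin

lemma wo_rel_omega1: "wo_rel (cardSuc natLeq)"
  unfolding wo_rel_def
  by (rule card_order_on_well_order_on[OF cardSuc_Card_order[OF natLeq_Card_order]])

text \<open>
  The ordinals \<open>\<alpha> \<le> \<omega>\<^sub>1\<close>, represented by the initial segments of \<open>cardSuc natLeq\<close>, a well-order
  of type \<open>\<omega>\<^sub>1\<close>, ordered by inclusion. The whole field represents \<open>\<omega>\<^sub>1\<close> itself; the proper
  initial segments represent exactly the countable ordinals.
\<close>

typedef ord_le_omega1 = "{S. wo_rel.ofilter (cardSuc natLeq) S}"
  morphisms seg_of Abs_ord
  by (rule exI[of _ "Field (cardSuc natLeq)"])
     (simp add: wo_rel.Field_ofilter[OF wo_rel_omega1])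

instantiation ord_le_omega1 :: wellorder
begin

definition less_eq_ord_le_omega1 :: "ord_le_omega1 \<Rightarrow> ord_le_omega1 \<Rightarrow> bool"
  where "\<alpha> \<le> \<beta> \<longleftrightarrow> seg_of \<alpha> \<subseteq> seg_of \<beta>"

definition less_ord_le_omega1 :: "ord_le_omega1 \<Rightarrow> ord_le_omega1 \<Rightarrow> bool"
  where "\<alpha> < \<beta> \<longleftrightarrow> seg_of \<alpha> \<subset> seg_of \<beta>"

instance
proof
  fix x y z :: ord_le_omega1
  show "x < y \<longleftrightarrow> x \<le> y \<and> \<not> y \<le> x" and "x \<le> x"
    by (auto simp: less_eq_ord_le_omega1_def less_ord_le_omega1_def)
  show "x \<le> y \<Longrightarrow> y \<le> z \<Longrightarrow> x \<le> z"
    by (auto simp: less_eq_ord_le_omega1_def)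
  show "x \<le> y \<Longrightarrow> y \<le> x \<Longrightarrow> x = y"
    by (simp add: less_eq_ord_le_omega1_def seg_of_inject)
  show "x \<le> y \<or> y \<le> x"
    using seg_of[of x] seg_of[of y] wo_rel.ofilter_linord[OF wo_rel_omega1]
    by (simp add: less_eq_ord_le_omega1_def)
next
  fix P :: "ord_le_omega1 \<Rightarrow> bool" and a
  assume step: "\<And>x. (\<And>y. y < x \<Longrightarrow> P y) \<Longrightarrow> P x"
  let ?r = "cardSuc natLeq"
  have wf: "wf (ofilterIncl ?r)"
    using wo_rel_omega1 by (simp add: wf_ofilterIncl wo_rel_def)
  have ofil: "wo_rel.ofilter ?r (seg_of x)" for x
    using seg_of[of x] by simp
  have sub: "seg_of x \<subseteq> Field ?r" for x
    using ofil[of x] wo_rel.ofilter_def[OF wo_rel_omega1] by blast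
  have below: "P x" if "seg_of x \<noteq> Field ?r" for x
    using that
  proof (induction "seg_of x" arbitrary: x rule: wf_induct_rule[OF wf])
    case 1
    show ?case
    proof (rule step)
      fix y assume "y < x"
      then have lt: "seg_of y \<subset> seg_of x" by (simp add: less_ord_le_omega1_def)
      then have ne: "seg_of y \<noteq> Field ?r" using sub[of x] by blast
      then have "(seg_of y, seg_of x) \<in> ofilterIncl ?r"
        using lt 1(2) ofil by (simp add: ofilterIncl_def)
      then show "P y" using 1(1) ne by blast
    qed
  qed
  show "P a"
  proof (rule step)
    fix y assume "y < a"
    then have "seg_of y \<subset> seg_of a" by (simp add: less_ord_le_omega1_def)
    then show "P y" using sub[of a] below by blast
  qed
qed

end

definition omega1 :: ord_le_omega1
  where "omega1 = Abs_ord (Field (cardSuc natLeq))"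

definition is_succ_of :: "'i::wellorder \<Rightarrow> 'i \<Rightarrow> bool"
  where "is_succ_of \<alpha> \<beta> \<longleftrightarrow> \<beta> < \<alpha> \<and> (\<forall>\<gamma>. \<beta> < \<gamma> \<longrightarrow> \<alpha> \<le> \<gamma>)"

lemma is_succ_of_unique:
  assumes "is_succ_of \<alpha> \<beta>" and "is_succ_of \<alpha> \<beta>'"
  shows "\<beta> = \<beta>'"
  using assms by (meson is_succ_of_def leD linorder_neqE)

lemma is_succ_of_The: "is_succ_of \<alpha> \<beta> \<Longrightarrow> (THE \<beta>. is_succ_of \<alpha> \<beta>) = \<beta>"
  by (blast intro: is_succ_of_unique)

definition seq_limits :: "'a::topological_space set \<Rightarrow> 'a set"
  where "seq_limits A = {x. \<exists>s. (\<forall>n. s n \<in> A) \<and> s \<longlonglongrightarrow> x}"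

text \<open>
  The iterated sequential closure \<open>[A]\<^sub>\<alpha>\<close>; the three branches are zero, successor and limit \<open>\<alpha>\<close>.
\<close>

function seq_closure :: "'a::topological_space set \<Rightarrow> 'i::wellorder \<Rightarrow> 'a set"
  where "seq_closure A \<alpha> =
    (if \<forall>\<beta>. \<alpha> \<le> \<beta> then A
     else if \<exists>\<beta>. is_succ_of \<alpha> \<beta> then seq_limits (seq_closure A (THE \<beta>. is_succ_of \<alpha> \<beta>))
     else (\<Union>\<beta>\<in>{..<\<alpha>}. seq_closure A \<beta>))"
  by pat_completeness auto
termination
  by (relation "inv_image {(\<beta>, \<alpha>). \<beta> < \<alpha>} snd")
     (auto intro: wf_inv_image wf simp: is_succ_of_The, auto simp: is_succ_of_def)

declare seq_closure.simps [simp del]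

definition sequential_space :: "'a::topological_space itself \<Rightarrow> bool"
  where "sequential_space _ \<longleftrightarrow>
    (\<forall>A::'a set. closure A - A \<noteq> {} \<longrightarrow>
      (\<exists>s. \<exists>x\<in>closure A - A. (\<forall>n. s n \<in> A) \<and> s \<longlonglongrightarrow> x))"

text \<open>Only meaningful for sequential spaces, where the set of candidates contains \<open>omega1\<close>.\<close>

definition sequential_order :: "'a::topological_space itself \<Rightarrow> ord_le_omega1"
  where "sequential_order _ = (LEAST \<gamma>. \<forall>A::'a set. closure A = seq_closure A \<gamma>)"

text \<open>
  A subset of \<open>'a\<close> is identified with its characteristic function in \<open>'a \<Rightarrow> bool\<close>, which, like
  \<open>nat \<Rightarrow> nat\<close> (the irrationals), carries the product topology of discrete factors.
\<close>

definition analytic_topology :: "'a::topological_space itself \<Rightarrow> bool"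
  where "analytic_topology _ \<longleftrightarrow>
    (\<exists>f :: (nat \<Rightarrow> nat) \<Rightarrow> ('a \<Rightarrow> bool).
      continuous_on UNIV f \<and> range f = {P. open {x. P x}})"

end

theory Submission
  imports Defs
begin

text \<open>
  Let \<open>G\<close> be a countable sequential group with analytic topology, and let open sets be coded by
  points of the Baire space. Removing the codes of those neighbourhoods \<open>U\<close> of 0 for which a
  countable family of large sets (meaning: the differences of the closure form a sequential
  neighbourhood of 0) has a member inside \<open>U\<close>, either nothing is left or a closed set \<open>H\<close>.

  If nothing is left, the differences give countably many sequential neighbourhoods of 0
  refining all neighbourhoods. In a sequential group this forces first countability, hence
  metrizability.

  If \<open>H\<close> is nonempty, Baire category on \<open>H\<close> yields increasing closed sets \<open>E n\<close> such that every
  sequence converging to 0 is eventually in some \<open>E n\<close>, while each \<open>E n\<close> is avoided by some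
  sequence converging to 0. As in a \<open>k\<^sub>\<omega>\<close>-group, one can then build, by induction on
  \<open>\<gamma> < \<omega>\<^sub>1\<close>, sets whose closure contains 0 but whose \<open>\<gamma>\<close>-th sequential closure does not, so
  the sequential order is \<open>\<omega>\<^sub>1\<close>.
\<close>

section \<open>Countable ordinals and iterated sequential closure\<close>

lemma countable_card_le_natLeq:
  includes cardinal_syntax
  shows "countable A \<longleftrightarrow> |A| \<le>o natLeq"
proof -
  have "countable A \<longleftrightarrow> |A| \<le>o |UNIV::nat set|"
    unfolding countable_def card_of_ordLeq[symmetric] by auto
  then show ?thesis using card_of_nat ordLeq_ordIso_trans ordIso_symmetric by blast
qed

lemma seg_of_ofilter: "wo_rel.ofilter (cardSuc natLeq) (seg_of \<alpha>)"
  using seg_of[of \<alpha>] by simp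

lemma seg_of_omega1: "seg_of omega1 = Field (cardSuc natLeq)"
  unfolding omega1_def by (simp add: Abs_ord_inverse wo_rel.Field_ofilter[OF wo_rel_omega1])

lemma seg_of_subset_Field: "seg_of \<alpha> \<subseteq> Field (cardSuc natLeq)"
  using seg_of_ofilter wo_rel.ofilter_def[OF wo_rel_omega1] by blast

lemma countable_underS_omega1:
  includes cardinal_syntax
  assumes "x \<in> Field (cardSuc natLeq)"
  shows "countable (underS (cardSuc natLeq) x)"
proof -
  have "|underS (cardSuc natLeq) x| <o cardSuc natLeq"
    by (rule card_of_underS[OF cardSuc_Card_order[OF natLeq_Card_order] assms])
  then have "|underS (cardSuc natLeq) x| \<le>o natLeq"
    using cardSuc_ordLeq_ordLess[OF natLeq_Card_order card_of_Card_order] by blast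
  then show ?thesis by (simp add: countable_card_le_natLeq)
qed

lemma uncountable_Field_omega1:
  includes cardinal_syntax
  shows "uncountable (Field (cardSuc natLeq))"
proof
  assume "countable (Field (cardSuc natLeq))"
  then have "|Field (cardSuc natLeq)| \<le>o natLeq" by (simp add: countable_card_le_natLeq)
  moreover have "cardSuc natLeq =o |Field (cardSuc natLeq)|"
    using card_of_Field_ordIso[OF cardSuc_Card_order[OF natLeq_Card_order]] ordIso_symmetric by blast
  ultimately have "cardSuc natLeq \<le>o natLeq"
    using ordIso_ordLeq_trans by blast
  then show False
    using cardSuc_greater[OF natLeq_Card_order] not_ordLess_ordLeq by blast
qed

lemma seg_of_less_omega1:
  assumes "\<alpha> < omega1"
  obtains x where "x \<in> Field (cardSuc natLeq)" "seg_of \<alpha> = underS (cardSuc natLeq) x"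
  using assms seg_of_ofilter[of \<alpha>] wo_rel.ofilter_underS_Field[OF wo_rel_omega1]
  by (auto simp: less_ord_le_omega1_def seg_of_omega1)

lemma countable_seg_of: "\<alpha> < omega1 \<Longrightarrow> countable (seg_of \<alpha>)"
  by (metis seg_of_less_omega1 countable_underS_omega1)

text \<open>A proper initial segment is determined by the least element outside it. For segments
  properly inside \<open>seg_of \<gamma>\<close> this element lies in the countable set
  \<open>seg_of \<gamma>\<close>.\<close>

lemma countable_lessThan_omega1:
  assumes "\<gamma> < omega1"
  shows "countable {..<\<gamma>}"
proof -
  have "seg_of ` {..<\<gamma>} \<subseteq> underS (cardSuc natLeq) ` seg_of \<gamma>"
  proof
    fix S assume "S \<in> seg_of ` {..<\<gamma>}"
    then obtain \<beta> where \<beta>: "\<beta> < \<gamma>" "S = seg_of \<beta>" by auto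
    then have "\<beta> < omega1" using assms by simp
    then obtain x where x: "x \<in> Field (cardSuc natLeq)" "S = underS (cardSuc natLeq) x"
      using \<beta>(2) by (metis seg_of_less_omega1)
    have "x \<in> seg_of \<gamma>"
    proof (rule ccontr)
      assume nx: "x \<notin> seg_of \<gamma>"
      obtain y where y: "y \<in> seg_of \<gamma>" "y \<notin> seg_of \<beta>"
        using \<beta>(1) by (auto simp: less_ord_le_omega1_def)
      have yF: "y \<in> Field (cardSuc natLeq)" using y(1) seg_of_subset_Field by blast
      have "(x, y) \<notin> cardSuc natLeq"
        using nx y(1) seg_of_ofilter[of \<gamma>] wo_rel.ofilter_def[OF wo_rel_omega1]
        by (auto simp: under_def)
      moreover have "x \<noteq> y" using nx y(1) by blast
      moreover have "(x, y) \<in> cardSuc natLeq \<or> (y, x) \<in> cardSuc natLeq"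
        using wo_rel.TOTALS[OF wo_rel_omega1] x(1) yF by blast
      ultimately have "y \<in> underS (cardSuc natLeq) x" by (auto simp: underS_def)
      then show False using y(2) x(2) \<beta>(2) by simp
    qed
    then show "S \<in> underS (cardSuc natLeq) ` seg_of \<gamma>" using x(2) by blast
  qed
  then have "countable (seg_of ` {..<\<gamma>})"
    by (rule countable_subset) (intro countable_image countable_seg_of[OF assms])
  then show ?thesis
    by (rule countable_image_inj_on) (simp add: inj_on_def seg_of_inject)
qed

text \<open>A union of countably many countable segments misses some \<open>x\<close>; the segment
  \<open>under ?r x\<close> contains \<open>x\<close>, so it exceeds all of them, and it is still
  countable.\<close>

lemma countable_bounded_omega1:
  assumes "countable B" and "B \<subseteq> {..<omega1}"
  obtains \<beta> where "\<beta> < omega1" "\<And>\<alpha>. \<alpha> \<in> B \<Longrightarrow> \<alpha> < \<beta>"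
proof -
  let ?r = "cardSuc natLeq"
  have "countable (\<Union>\<alpha>\<in>B. seg_of \<alpha>)"
    using assms countable_seg_of by blast
  then have "\<not> Field ?r \<subseteq> (\<Union>\<alpha>\<in>B. seg_of \<alpha>)"
    using uncountable_Field_omega1 by (meson countable_subset)
  then obtain x where x: "x \<in> Field ?r" "\<And>\<alpha>. \<alpha> \<in> B \<Longrightarrow> x \<notin> seg_of \<alpha>" by blast
  have xu: "x \<in> under ?r x"
    using x(1) wo_rel.REFL[OF wo_rel_omega1] by (simp add: Refl_under_in)
  have seg: "seg_of (Abs_ord (under ?r x)) = under ?r x"
    by (simp add: Abs_ord_inverse wo_rel.under_ofilter[OF wo_rel_omega1])
  have cu: "countable (under ?r x)"
    using countable_underS_omega1[OF x(1)]
    by (rule countable_subset[rotated, OF countable_insert[where a = x]]) (auto simp: under_def underS_def)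
  show ?thesis
  proof
    have "under ?r x \<noteq> Field ?r" using cu uncountable_Field_omega1 by metis
    then show "Abs_ord (under ?r x) < omega1"
      using seg_of_subset_Field[of "Abs_ord (under ?r x)"]
      by (auto simp: less_ord_le_omega1_def seg_of_omega1 seg)
    fix \<alpha> assume "\<alpha> \<in> B"
    have "x \<notin> seg_of \<alpha>" by (rule x(2)[OF \<open>\<alpha> \<in> B\<close>])
    then have "\<not> seg_of (Abs_ord (under ?r x)) \<subseteq> seg_of \<alpha>"
      using xu seg by blast
    then show "\<alpha> < Abs_ord (under ?r x)"
      using less_eq_ord_le_omega1_def not_le by blast
  qed
qed

section \<open>Sequential limits and the stages of the sequential closure\<close>

lemma seq_limitsI: "(\<And>n. s n \<in> A) \<Longrightarrow> s \<longlonglongrightarrow> x \<Longrightarrow> x \<in> seq_limits A"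
  by (auto simp: seq_limits_def)

lemma seq_limits_increasing: "A \<subseteq> seq_limits A"
  by (auto intro!: seq_limitsI[where s = "\<lambda>_. _"])

lemma seq_limits_mono: "A \<subseteq> B \<Longrightarrow> seq_limits A \<subseteq> seq_limits B"
  unfolding seq_limits_def by blast

lemma eventually_in_imp_seq_limits:
  assumes "eventually (\<lambda>n. s n \<in> A) sequentially" and "s \<longlonglongrightarrow> x"
  shows "x \<in> seq_limits A"
proof -
  obtain N where "\<And>n. n \<ge> N \<Longrightarrow> s n \<in> A"
    using assms(1) by (auto simp: eventually_sequentially)
  then show ?thesis
    using assms(2) by (intro seq_limitsI[where s = "\<lambda>n. s (n + N)"] LIMSEQ_ignore_initial_segment) auto
qed

lemma seq_limits_subset_closure: "seq_limits A \<subseteq> closure A"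
proof
  fix x assume "x \<in> seq_limits A"
  then obtain s where "\<And>n. s n \<in> A" "s \<longlonglongrightarrow> x" by (auto simp: seq_limits_def)
  moreover from this(1) have "eventually (\<lambda>n. s n \<in> closure A) sequentially"
    using closure_subset by (intro always_eventually) blast
  ultimately show "x \<in> closure A"
    using Lim_in_closed_set[OF closed_closure _ sequentially_bot] by blast
qed

lemma seq_closure_zero: "(\<And>\<beta>. \<alpha> \<le> \<beta>) \<Longrightarrow> seq_closure A \<alpha> = A"
  by (rule trans[OF seq_closure.simps if_P]) blast

lemma seq_closure_succ:
  assumes "is_succ_of \<alpha> \<beta>"
  shows "seq_closure A \<alpha> = seq_limits (seq_closure A \<beta>)"
proof -
  have "\<not> (\<forall>\<beta>. \<alpha> \<le> \<beta>)" using assms unfolding is_succ_of_def by (meson leD)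
  moreover have "\<exists>\<beta>. is_succ_of \<alpha> \<beta>" using assms by blast
  ultimately have "seq_closure A \<alpha> = seq_limits (seq_closure A (THE \<beta>. is_succ_of \<alpha> \<beta>))"
    by (rule trans[OF seq_closure.simps trans[OF if_not_P if_P]])
  then show ?thesis by (simp only: is_succ_of_The[OF assms])
qed

lemma seq_closure_limit:
  assumes "\<beta> < \<alpha>" and "\<nexists>\<delta>. is_succ_of \<alpha> \<delta>"
  shows "seq_closure A \<alpha> = (\<Union>\<beta>\<in>{..<\<alpha>}. seq_closure A \<beta>)"
proof -
  have "\<not> (\<forall>\<beta>. \<alpha> \<le> \<beta>)" using assms(1) leD by blast
  then show ?thesis
    using assms(2) by (rule trans[OF seq_closure.simps trans[OF if_not_P if_not_P]])
qed

text \<open>Merges the successor and limit branches, so that inductions over stages treat both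
  alike. In the limit branch, a point of an earlier stage is the limit of a constant
  sequence.\<close>

lemma seq_closure_cases:
  assumes "x \<in> seq_closure A \<alpha>"
  shows "x \<in> A \<or> (\<exists>\<beta><\<alpha>. x \<in> seq_limits (seq_closure A \<beta>))"
proof (cases "\<exists>\<beta>. \<beta> < \<alpha>")
  case False
  then have "seq_closure A \<alpha> = A" by (intro seq_closure_zero) (meson not_le)
  then show ?thesis using assms by blast
next
  case True
  then obtain \<beta>\<^sub>0 where \<beta>\<^sub>0: "\<beta>\<^sub>0 < \<alpha>" by blast
  show ?thesis
  proof (cases "\<exists>\<beta>. is_succ_of \<alpha> \<beta>")
    case True
    then show ?thesis using assms seq_closure_succ unfolding is_succ_of_def by blast
  next
    case False
    then have "x \<in> (\<Union>\<beta>\<in>{..<\<alpha>}. seq_closure A \<beta>)"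
      using assms seq_closure_limit[OF \<beta>\<^sub>0 False] by blast
    then show ?thesis
      using seq_limits_increasing by blast
  qed
qed

lemma seq_closure_mono:
  assumes "\<beta> \<le> \<alpha>"
  shows "seq_closure A \<beta> \<subseteq> seq_closure A \<alpha>"
  using assms
proof (induction \<alpha> rule: less_induct)
  case (less \<alpha>)
  show ?case
  proof (cases "\<beta> = \<alpha>")
    case False
    then have lt: "\<beta> < \<alpha>" using less.prems by simp
    show ?thesis
    proof (cases "\<exists>\<delta>. is_succ_of \<alpha> \<delta>")
      case True
      then obtain \<delta> where \<delta>: "is_succ_of \<alpha> \<delta>" by blast
      then have "\<beta> \<le> \<delta>" using lt unfolding is_succ_of_def by (meson leD not_le)
      then have "seq_closure A \<beta> \<subseteq> seq_closure A \<delta>"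
        using less.IH \<delta> unfolding is_succ_of_def by blast
      then show ?thesis
        using seq_limits_increasing unfolding seq_closure_succ[OF \<delta>] by blast
    next
      case NS: False
      then show ?thesis unfolding seq_closure_limit[OF lt NS] using lt by blast
    qed
  qed simp
qed

lemma seq_closure_increasing: "A \<subseteq> seq_closure A \<alpha>"
proof -
  define z where "z = (LEAST \<beta>::'b. True)"
  have z: "z \<le> \<beta>" for \<beta> unfolding z_def by (rule Least_le) simp
  then have "seq_closure A z = A" by (rule seq_closure_zero)
  then show ?thesis using seq_closure_mono[OF z] by metis
qed

text \<open>The hypothesis guarantees that \<open>\<beta>\<close> has a successor, namely the least
  larger element, and this successor is at most \<open>\<alpha>\<close>.\<close>

lemma seq_limits_seq_closure:
  assumes "\<beta> < \<alpha>"
  shows "seq_limits (seq_closure A \<beta>) \<subseteq> seq_closure A \<alpha>"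
proof -
  define \<sigma> where "\<sigma> = (LEAST \<gamma>. \<beta> < \<gamma>)"
  have "\<beta> < \<sigma>" unfolding \<sigma>_def by (rule LeastI[where P = "\<lambda>\<gamma>. \<beta> < \<gamma>", OF assms])
  moreover have le: "\<sigma> \<le> \<gamma>" if "\<beta> < \<gamma>" for \<gamma> unfolding \<sigma>_def using that by (rule Least_le)
  ultimately have s: "is_succ_of \<sigma> \<beta>" by (simp add: is_succ_of_def)
  then have "seq_closure A \<sigma> = seq_limits (seq_closure A \<beta>)" by (rule seq_closure_succ)
  then show ?thesis using seq_closure_mono[OF le[OF assms], of A] by simp
qed

lemma seq_closure_subset_closure: "seq_closure A \<alpha> \<subseteq> closure A"
proof (induction \<alpha> rule: less_induct)
  case (less \<alpha>)
  show ?case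
  proof
    fix x assume "x \<in> seq_closure A \<alpha>"
    then consider "x \<in> A" | \<beta> where "\<beta> < \<alpha>" "x \<in> seq_limits (seq_closure A \<beta>)"
      using seq_closure_cases by blast
    then show "x \<in> closure A"
    proof cases
      case 2
      then have "x \<in> closure (closure A)"
        using less.IH seq_limits_mono seq_limits_subset_closure by blast
      then show ?thesis by simp
    qed (use closure_subset in blast)
  qed
qed

lemma sequential_space_closedI:
  fixes A :: "'a::topological_space set"
  assumes "sequential_space TYPE('a)" and "seq_limits A \<subseteq> A"
  shows "closed A"
proof (rule ccontr)
  assume "\<not> closed A"
  then have "closure A - A \<noteq> {}" using closure_subset[of A] closure_eq[of A] by auto
  then obtain s x where "x \<in> closure A - A" "\<forall>n. s n \<in> A" "s \<longlonglongrightarrow> x"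
    using assms(1) unfolding sequential_space_def by blast
  then show False using assms(2) by (auto simp: seq_limits_def)
qed

text \<open>A sequence meets only countably many stages, and these have a common countable bound.
  Hence the union of the countable stages is sequentially closed, and so closed.\<close>

lemma seq_closure_omega1:
  fixes A :: "'a::topological_space set"
  assumes "sequential_space TYPE('a)"
  shows "seq_closure A omega1 = closure A"
proof
  let ?C = "\<Union>\<beta>\<in>{..<omega1}. seq_closure A \<beta>"
  have "seq_limits ?C \<subseteq> ?C"
  proof
    fix x assume "x \<in> seq_limits ?C"
    then obtain s where s: "\<And>n. s n \<in> ?C" "s \<longlonglongrightarrow> x" by (auto simp: seq_limits_def)
    have "\<forall>n. \<exists>\<beta>. \<beta> < omega1 \<and> s n \<in> seq_closure A \<beta>" using s(1) by blast
    then obtain b where b: "\<And>n. b n < omega1" "\<And>n. s n \<in> seq_closure A (b n)" by metis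
    obtain \<beta> where \<beta>: "\<beta> < omega1" "\<And>n. b n < \<beta>"
      by (rule countable_bounded_omega1[of "range b"]) (use b(1) in auto)
    \<comment> \<open>A second bound leaves room for the stage at which the limit is added.\<close>
    obtain \<beta>' where \<beta>': "\<beta>' < omega1" "\<beta> < \<beta>'"
      by (rule countable_bounded_omega1[of "{\<beta>}"]) (use \<beta>(1) in auto)
    have "s n \<in> seq_closure A \<beta>" for n
      using b(2) seq_closure_mono[OF less_imp_le[OF \<beta>(2)[of n]]] by blast
    then have "x \<in> seq_limits (seq_closure A \<beta>)" using s(2) by (rule seq_limitsI)
    then show "x \<in> ?C" using seq_limits_seq_closure[OF \<beta>'(2)] \<beta>'(1) by blast
  qed
  then have "closed ?C" by (rule sequential_space_closedI[OF assms])
  moreover obtain \<beta> where "\<beta> < omega1" by (rule countable_bounded_omega1[of "{}"]) auto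
  then have "A \<subseteq> ?C" using seq_closure_increasing[of A \<beta>] by blast
  ultimately have "closure A \<subseteq> ?C" by (simp add: closure_minimal)
  also have "\<dots> \<subseteq> seq_closure A omega1" using seq_closure_mono[OF less_imp_le] by blast
  finally show "closure A \<subseteq> seq_closure A omega1" .
qed (rule seq_closure_subset_closure)

lemma closure_eq_seq_closure_sequential_order:
  fixes A :: "'a::topological_space set"
  assumes "sequential_space TYPE('a)"
  shows "closure A = seq_closure A (sequential_order TYPE('a))"
proof -
  have "\<forall>A::'a set. closure A = seq_closure A omega1"
    by (simp add: seq_closure_omega1[OF assms])
  then have "\<forall>A::'a set. closure A = seq_closure A (sequential_order TYPE('a))"
    unfolding sequential_order_def by (rule LeastI)
  then show ?thesis by blast
qed

text \<open>One step of sequential limits already gives the closure, so any countable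
  \<open>\<gamma>\<close> with some \<open>\<beta>\<close> below it is an upper bound.\<close>

lemma sequential_order_less_omega1I:
  assumes "\<And>A::'a::topological_space set. closure A \<subseteq> seq_limits A"
  shows "sequential_order TYPE('a) < omega1"
proof -
  obtain \<beta> where \<beta>: "\<beta> < omega1" by (rule countable_bounded_omega1[of "{}"]) auto
  obtain \<gamma> where \<gamma>: "\<gamma> < omega1" "\<beta> < \<gamma>"
    by (rule countable_bounded_omega1[of "{\<beta>}"]) (use \<beta>(1) in auto)
  have "closure A = seq_closure A \<gamma>" for A :: "'a set"
    using assms[of A] seq_limits_mono[OF seq_closure_increasing[of A \<beta>]]
      seq_limits_seq_closure[OF \<gamma>(2), of A] seq_closure_subset_closure[of A \<gamma>] by blast
  then have "sequential_order TYPE('a) \<le> \<gamma>"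
    unfolding sequential_order_def by (intro Least_le) blast
  then show ?thesis using \<gamma>(1) by simp
qed

section \<open>Sets of large sequential rank\<close>

lemma open_left_translation_vimage:
  fixes x :: "'a::topological_group_add"
  assumes "open U"
  shows "open {z. x + z \<in> U}"
proof -
  have "continuous_on UNIV (\<lambda>z. x + z)" by (intro continuous_intros)
  then have "open ((\<lambda>z. x + z) -` U)" by (rule open_vimage[OF assms])
  then show ?thesis by (simp add: vimage_def)
qed

lemma closure_left_translation:
  fixes x :: "'a::topological_group_add"
  shows "closure ((+) x ` M) = (+) x ` closure M"
proof -
  have sub: "(+) y ` closure N \<subseteq> closure ((+) y ` N)" for y :: 'a and N
    by (rule image_closure_subset) (auto intro!: continuous_intros closure_subset[THEN subsetD])
  have "z \<in> (+) x ` closure M" if "z \<in> closure ((+) x ` M)" for z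
  proof -
    have "- x + z \<in> closure ((+) (- x) ` (+) x ` M)"
      using sub[of "- x" "(+) x ` M"] that by blast
    then have "- x + z \<in> closure M" by (simp add: image_image add.assoc[symmetric])
    moreover have "z = x + (- x + z)" by (simp add: add.assoc[symmetric])
    ultimately show ?thesis by blast
  qed
  then show ?thesis using sub by blast
qed

lemma seq_closure_left_translation:
  fixes x :: "'a::topological_group_add"
  assumes "z \<in> seq_closure ((+) x ` M) \<beta>"
  shows "- x + z \<in> seq_closure M \<beta>"
  using assms
proof (induction \<beta> arbitrary: z rule: less_induct)
  case (less \<beta>)
  from seq_closure_cases[OF less.prems] show ?case
  proof
    assume "z \<in> (+) x ` M"
    then have "- x + z \<in> M" by (auto simp: add.assoc[symmetric])
    then show ?thesis using seq_closure_increasing by blast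
  next
    assume "\<exists>\<delta><\<beta>. z \<in> seq_limits (seq_closure ((+) x ` M) \<delta>)"
    then obtain \<delta> s where s: "\<delta> < \<beta>" "\<And>n. s n \<in> seq_closure ((+) x ` M) \<delta>" "s \<longlonglongrightarrow> z"
      by (auto simp: seq_limits_def)
    have "- x + s n \<in> seq_closure M \<delta>" for n by (rule less.IH[OF s(1) s(2)])
    moreover have "(\<lambda>n. - x + s n) \<longlonglongrightarrow> - x + z" by (intro tendsto_intros s(3))
    ultimately have "- x + z \<in> seq_limits (seq_closure M \<delta>)" by (rule seq_limitsI)
    then show ?thesis using seq_limits_seq_closure[OF s(1)] by blast
  qed
qed

lemma t3_closed_nhd:
  fixes x :: "'a::t3_space"
  assumes "open U" "x \<in> U"
  obtains V where "open V" "x \<in> V" "closure V \<subseteq> U"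
proof -
  obtain A' where A': "x \<in> A'" "closed A'" "A' \<subseteq> U" "eventually (\<lambda>y. y \<in> A') (nhds x)"
    using nhds_closed[OF assms(2,1)] by blast
  then obtain V where "open V" "x \<in> V" "V \<subseteq> A'" by (auto simp: eventually_nhds)
  then show ?thesis using A' that closure_minimal by (metis order_trans)
qed

text \<open>
  The set \<open>M\<close> is assembled from translates of small sets \<open>N i\<close> to points \<open>y i\<close>
  converging to 0. Since sequences converging to 0 eventually enter some \<open>E m\<close>, while
  \<open>closure (N i) - {0}\<close> misses \<open>E i\<close>, a sequence can only converge to 0 through the points
  \<open>y i\<close>, whose rank in \<open>y i + N i\<close> is large.
\<close>

lemma seq_closure_rank_step:
  fixes E :: "nat \<Rightarrow> 'a::{topological_group_add, t3_space, countable} set"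
    and F :: "nat \<Rightarrow> 'i::wellorder set"
  assumes closed_E: "\<And>n. closed (E n)" and zero_E: "\<And>n. 0 \<in> E n" and "incseq E"
    and cover: "\<And>s. s \<longlonglongrightarrow> 0 \<Longrightarrow> \<exists>m. \<forall>\<^sub>F k in sequentially. s k \<in> E m"
    and avoid: "\<And>n. \<exists>c. c \<longlonglongrightarrow> 0 \<and> (\<forall>k. c k \<notin> E n)"
    and step: "\<And>i W. open W \<Longrightarrow> 0 \<in> W \<Longrightarrow>
      \<exists>N\<subseteq>W. 0 \<in> closure N \<and> (closure N - {0}) \<inter> E i = {} \<and> (\<forall>\<beta>\<in>F i. 0 \<notin> seq_closure N \<beta>)"
    and cofinal: "\<And>\<delta>. \<delta> < \<gamma> \<Longrightarrow> \<forall>\<^sub>F i in sequentially. \<delta> \<in> F i"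
    and W: "open W" "0 \<in> W"
  shows "\<exists>M\<subseteq>W. 0 \<in> closure M \<and> (closure M - {0}) \<inter> E n = {} \<and> (\<forall>\<beta>\<le>\<gamma>. 0 \<notin> seq_closure M \<beta>)"
proof -
  obtain c where c: "c \<longlonglongrightarrow> 0" "\<And>k. c k \<notin> E n" using avoid by blast
  \<comment> \<open>By countability \<open>g\<close> lists the whole group; stage \<open>i\<close>
    will keep the point \<open>g i\<close>, if nonzero, out of the closure of the next neighbourhood
    of 0.\<close>
  define g :: "nat \<Rightarrow> 'a" where "g = from_nat"
  define P where "P = (\<lambda>V::'a set. open V \<and> 0 \<in> V \<and> V \<subseteq> W)"
  \<comment> \<open>\<open>R\<close> holds the data of stage \<open>i\<close>; indices of
    \<open>c\<close> from \<open>i\<close> on make the chosen points converge to 0. In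
    \<open>Q\<close> the next neighbourhood misses \<open>Y\<close>, so the sets \<open>Y\<close> of
    different stages will be disjoint.\<close>
  define R where "R = (\<lambda>i V y O' Y. y \<in> c ` {i..} \<and> open O' \<and> closed Y \<and> y \<in> O' \<and> O' \<subseteq> Y \<and> Y \<subseteq> V - E n)"
  define Q where "Q = (\<lambda>i (V::'a set) V'. V' \<subseteq> V \<and> (g i \<noteq> 0 \<longrightarrow> g i \<notin> closure V') \<and>
    (\<exists>y O' Y. R i V y O' Y \<and> Y \<inter> V' = {}))"
  have "\<exists>V. \<forall>i. P (V i) \<and> Q i (V i) (V (Suc i))"
  proof (rule dependent_nat_choice)
    show "\<exists>V. P V" using W by (auto simp: P_def)
    fix V i assume "P V"
    then have V: "open V" "0 \<in> V" "V \<subseteq> W" by (auto simp: P_def)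
    have "\<forall>\<^sub>F k in sequentially. c k \<in> V" using topological_tendstoD[OF c(1) V(1,2)] .
    then obtain K where K: "\<And>k. k \<ge> K \<Longrightarrow> c k \<in> V" by (auto simp: eventually_sequentially)
    define y where "y = c (max i K)"
    have y: "y \<in> c ` {i..}" "y \<in> V - E n" using K c(2) by (auto simp: y_def)
    have "y \<noteq> 0" using y(2) zero_E by auto
    have "open ((V - E n) \<inter> - {0})" using V(1) closed_E by (intro open_Int open_Diff) auto
    moreover have "y \<in> (V - E n) \<inter> - {0}" using y(2) \<open>y \<noteq> 0\<close> by auto
    ultimately obtain O' where O': "open O'" "y \<in> O'" "closure O' \<subseteq> (V - E n) \<inter> - {0}"
      by (rule t3_closed_nhd)
    define U where "U = V \<inter> - closure O' \<inter> (if g i = 0 then UNIV else - {g i})"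
    have "open U" "0 \<in> U" using V O' by (auto simp: U_def)
    then obtain V' where V': "open V'" "0 \<in> V'" "closure V' \<subseteq> U" by (rule t3_closed_nhd)
    have sub: "V' \<subseteq> U" using V'(3) closure_subset by blast
    have "R i V y O' (closure O')"
      unfolding R_def using y(1) O' closure_subset[of O'] by auto
    moreover have "closure O' \<inter> V' = {}" using sub by (auto simp: U_def)
    moreover have "g i \<notin> closure V'" if "g i \<noteq> 0" using V'(3) that by (auto simp: U_def)
    moreover have "V' \<subseteq> V" using sub by (auto simp: U_def)
    ultimately have "Q i V V'" unfolding Q_def by blast
    moreover have "P V'" using V' \<open>V' \<subseteq> V\<close> V(3) by (auto simp: P_def)
    ultimately show "\<exists>V'. P V' \<and> Q i V V'" by blast
  qed
  then obtain V where PV: "\<And>i. P (V i)" and QV: "\<And>i. Q i (V i) (V (Suc i))" by blast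
  have "\<forall>i. \<exists>y O' Y. R i (V i) y O' Y \<and> Y \<inter> V (Suc i) = {}" using QV by (auto simp: Q_def)
  then obtain y O' Y where R: "\<And>i. R i (V i) (y i) (O' i) (Y i)" and YV: "\<And>i. Y i \<inter> V (Suc i) = {}"
    by metis
  have open_O: "\<And>i. open (O' i)" and closed_Y: "\<And>i. closed (Y i)" and y_O: "\<And>i. y i \<in> O' i"
    and O_Y: "\<And>i. O' i \<subseteq> Y i" and Y_V: "\<And>i. Y i \<subseteq> V i" and Y_E: "\<And>i. Y i \<inter> E n = {}"
    and y_c: "\<And>i. y i \<in> c ` {i..}"
    using R by (auto simp: R_def)
  have V0: "0 \<in> V i" for i using PV by (simp add: P_def)
  have "decseq V" by (rule decseq_SucI) (use QV in \<open>auto simp: Q_def\<close>)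
  then have V_anti: "i \<le> l \<Longrightarrow> V l \<subseteq> V i" for i l by (simp add: decseqD)
  have Y0: "0 \<notin> Y i" for i using YV[of i] V0[of "Suc i"] by blast
  have Y_less: "Y i \<inter> Y l = {}" if "i < l" for i l
    using YV[of i] Y_V[of l] V_anti[of "Suc i" l] that by auto
  have Y_disj: "Y i \<inter> Y l = {}" if "i \<noteq> l" for i l
    using that Y_less[of i l] Y_less[of l i] by (cases "i < l") auto
  have y_lim: "y \<longlonglongrightarrow> 0"
  proof -
    obtain m where m: "\<And>i. y i = c (m i)" "\<And>i. i \<le> m i"
      using choice[of "\<lambda>i m. y i = c m \<and> i \<le> m"] y_c by (auto simp: image_iff)
    have "filterlim m at_top sequentially"
      by (rule filterlim_at_top_mono[OF filterlim_ident]) (use m(2) in auto)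
    from filterlim_compose[OF c(1) this] have "(\<lambda>i. y i) \<longlonglongrightarrow> 0" by (simp only: m(1))
    then show ?thesis by simp
  qed
  \<comment> \<open>If \<open>z = g j\<close>, all \<open>Y l\<close> with \<open>l > j\<close> lie
    in \<open>V (Suc j)\<close>, whose closure omits \<open>z\<close>. The finitely many others are
    closed, and at most one of them contains \<open>z\<close>.\<close>
  have loc: "\<exists>i U. open U \<and> z \<in> U \<and> (\<forall>l. l \<noteq> i \<longrightarrow> U \<inter> Y l = {})" if "z \<noteq> 0" for z
  proof -
    obtain j where j: "g j = z" unfolding g_def by (metis from_nat_to_nat)
    then have zV: "z \<notin> closure (V (Suc j))" using QV[of j] that by (auto simp: Q_def)
    obtain i where i: "\<And>l. l \<noteq> i \<Longrightarrow> z \<notin> Y l" using Y_disj by blast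
    define U where "U = - closure (V (Suc j)) \<inter> - (\<Union>l\<in>{..j} - {i}. Y l)"
    have "open U" unfolding U_def using closed_Y by (intro open_Int open_Compl closed_UN) auto
    moreover have "z \<in> U" using zV i by (auto simp: U_def)
    moreover have "U \<inter> Y l = {}" if "l \<noteq> i" for l
    proof (cases "l \<le> j")
      case False
      then have "Y l \<subseteq> V (Suc j)" using Y_V[of l] V_anti[of "Suc j" l] by auto
      then show ?thesis using closure_subset[of "V (Suc j)"] by (auto simp: U_def)
    qed (use that in \<open>auto simp: U_def\<close>)
    ultimately show ?thesis by blast
  qed
  have "\<forall>i. \<exists>N\<subseteq>{z. y i + z \<in> O' i}. 0 \<in> closure N \<and> (closure N - {0}) \<inter> E i = {} \<and>
      (\<forall>\<beta>\<in>F i. 0 \<notin> seq_closure N \<beta>)"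
  proof
    fix i show "\<exists>N\<subseteq>{z. y i + z \<in> O' i}. 0 \<in> closure N \<and> (closure N - {0}) \<inter> E i = {} \<and>
      (\<forall>\<beta>\<in>F i. 0 \<notin> seq_closure N \<beta>)"
      by (rule step) (use open_O y_O in \<open>auto intro: open_left_translation_vimage\<close>)
  qed
  then obtain N where N: "\<And>i. N i \<subseteq> {z. y i + z \<in> O' i}" "\<And>i. 0 \<in> closure (N i)"
    "\<And>i. (closure (N i) - {0}) \<inter> E i = {}" "\<And>i \<beta>. \<beta> \<in> F i \<Longrightarrow> 0 \<notin> seq_closure (N i) \<beta>"
    by metis
  define T where "T = (\<lambda>i. (+) (y i) ` N i)"
  define M where "M = (\<Union>i. T i)"
  have T_Y: "T i \<subseteq> Y i" for i using N(1)[of i] O_Y[of i] by (auto simp: T_def)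
  have clT_Y: "closure (T i) \<subseteq> Y i" for i using T_Y closed_Y by (rule closure_minimal)
  have sT_Y: "seq_closure (T i) \<beta> \<subseteq> Y i" for i and \<beta> :: 'i
    using seq_closure_subset_closure clT_Y by blast
  have cl: "closure T' = (+) (y i) ` closure (N i)" if "T' = T i" for T' i
    using that by (simp add: T_def closure_left_translation)
  have clM: "z \<in> (\<Union>i. Y i)" if "z \<in> closure M" "z \<noteq> 0" for z
  proof -
    obtain i U where U: "open U" "z \<in> U" "\<And>l. l \<noteq> i \<Longrightarrow> U \<inter> Y l = {}" using loc[OF \<open>z \<noteq> 0\<close>] by blast
    have "z \<in> Y i"
    proof (rule ccontr)
      assume "z \<notin> Y i"
      have "open (U \<inter> - Y i)" using U(1) closed_Y by auto
      moreover have "(U \<inter> - Y i) \<inter> M = {}" using U(3) T_Y by (fastforce simp: M_def)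
      ultimately have "(U \<inter> - Y i) \<inter> closure M = {}" by (simp add: open_Int_closure_eq_empty)
      then show False using \<open>z \<notin> Y i\<close> U(2) that(1) by blast
    qed
    then show ?thesis by blast
  qed
  have y_cl: "y i \<in> closure M" for i
  proof -
    have "y i + 0 \<in> closure (T i)" using cl[of "T i" i] N(2)[of i] by blast
    then show ?thesis using closure_mono[of "T i" M] by (auto simp: M_def)
  qed
  have "0 \<in> closure (closure M)"
    using seq_limitsI[of y "closure M" 0] y_cl y_lim seq_limits_subset_closure by blast
  then have M0: "0 \<in> closure M" by simp
  \<comment> \<open>As long as 0 has not been reached, the pieces cannot mix: by \<open>loc\<close>,
    a sequence converging to a nonzero point eventually stays in a single piece.\<close>
  have part: "\<exists>i. z \<in> seq_closure (T i) \<beta>"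
    if "\<And>\<delta>. \<delta> < \<beta> \<Longrightarrow> 0 \<notin> seq_closure M \<delta>" "z \<in> seq_closure M \<beta>" "z \<noteq> 0" for z and \<beta> :: 'i
    using that
  proof (induction \<beta> arbitrary: z rule: less_induct)
    case (less \<beta>)
    from seq_closure_cases[OF less.prems(2)] show ?case
    proof
      assume "z \<in> M"
      then show ?thesis using seq_closure_increasing unfolding M_def by blast
    next
      assume "\<exists>\<delta><\<beta>. z \<in> seq_limits (seq_closure M \<delta>)"
      then obtain \<delta> s where s: "\<delta> < \<beta>" "\<And>k. s k \<in> seq_closure M \<delta>" "s \<longlonglongrightarrow> z"
        by (auto simp: seq_limits_def)
      have ex: "\<exists>i. s k \<in> seq_closure (T i) \<delta>" for k
      proof (rule less.IH[OF s(1) _ s(2)])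
        show "0 \<notin> seq_closure M \<delta>'" if "\<delta>' < \<delta>" for \<delta>'
          using less.prems(1) that s(1) by (meson less_trans)
        show "s k \<noteq> 0" using less.prems(1)[OF s(1)] s(2) by metis
      qed
      obtain i U where U: "open U" "z \<in> U" "\<And>l. l \<noteq> i \<Longrightarrow> U \<inter> Y l = {}"
        using loc[OF \<open>z \<noteq> 0\<close>] by blast
      have "\<forall>\<^sub>F k in sequentially. s k \<in> U" by (rule topological_tendstoD[OF s(3) U(1,2)])
      then have "\<forall>\<^sub>F k in sequentially. s k \<in> seq_closure (T i) \<delta>"
      proof eventually_elim
        case (elim k)
        obtain l where l: "s k \<in> seq_closure (T l) \<delta>" using ex by blast
        then have "s k \<in> Y l" using sT_Y by blast
        then have "l = i" using U(3)[of l] elim by blast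
        then show ?case using l by simp
      qed
      then have "z \<in> seq_limits (seq_closure (T i) \<delta>)" using s(3) by (rule eventually_in_imp_seq_limits)
      then show ?thesis using seq_limits_seq_closure[OF s(1)] by blast
    qed
  qed
  have rank: "0 \<notin> seq_closure M \<beta>" if "\<beta> \<le> \<gamma>" for \<beta>
    using that
  proof (induction \<beta> rule: less_induct)
    case (less \<beta>)
    show ?case
    proof
      assume "0 \<in> seq_closure M \<beta>"
      moreover have "0 \<notin> M" using T_Y Y0 by (auto simp: M_def)
      ultimately obtain \<delta> s where s: "\<delta> < \<beta>" "\<And>k. s k \<in> seq_closure M \<delta>" "s \<longlonglongrightarrow> 0"
        using seq_closure_cases[of 0 M \<beta>] by (auto simp: seq_limits_def)
      have no: "0 \<notin> seq_closure M \<delta>'" if "\<delta>' \<le> \<delta>" for \<delta>'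
        using less.IH[of \<delta>'] less.prems s(1) that by auto
      have s0: "s k \<noteq> 0" for k using no[of \<delta>] s(2)[of k] by auto
      have "\<exists>i. s k \<in> seq_closure (T i) \<delta>" for k
        using part[OF _ s(2) s0] no by simp
      then obtain i where i: "\<And>k. s k \<in> seq_closure (T (i k)) \<delta>" by metis
      \<comment> \<open>Every finite union of sets \<open>Y l\<close> is closed and omits 0, so
        \<open>s\<close> eventually leaves it.\<close>
      have i_lim: "filterlim i at_top sequentially"
        unfolding filterlim_at_top
      proof
        fix m
        have "open (- (\<Union>l\<in>{..<m}. Y l))" using closed_Y by (intro open_Compl closed_UN) auto
        moreover have "0 \<in> - (\<Union>l\<in>{..<m}. Y l)" using Y0 by auto
        ultimately have "\<forall>\<^sub>F k in sequentially. s k \<in> - (\<Union>l\<in>{..<m}. Y l)"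
          by (rule topological_tendstoD[OF s(3)])
        then show "\<forall>\<^sub>F k in sequentially. m \<le> i k"
        proof eventually_elim
          case (elim k)
          have "s k \<in> Y (i k)" using i sT_Y by blast
          then show ?case using elim by (meson ComplD UN_I lessThan_iff not_le)
        qed
      qed
      \<comment> \<open>Translating back gives a sequence converging to 0, hence eventually in some
        \<open>E m\<close> and so in \<open>E (i k)\<close>. As \<open>closure (N (i k))\<close>
        meets that set at most in 0, the terms would be 0, against the rank of
        \<open>N (i k)\<close>.\<close>
      define r where "r = (\<lambda>k. - y (i k) + s k)"
      have r_seq: "r k \<in> seq_closure (N (i k)) \<delta>" for k
        using seq_closure_left_translation i[of k] by (auto simp: r_def T_def)
      have "(\<lambda>k. y (i k)) \<longlonglongrightarrow> 0" by (rule filterlim_compose[OF y_lim i_lim])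
      from tendsto_add[OF tendsto_minus[OF this] s(3)] have "r \<longlonglongrightarrow> 0" by (simp add: r_def)
      then obtain m where m: "\<forall>\<^sub>F k in sequentially. r k \<in> E m" using cover by blast
      have "\<forall>\<^sub>F k in sequentially. m \<le> i k" using i_lim by (simp add: filterlim_at_top)
      moreover have "\<forall>\<^sub>F k in sequentially. \<delta> \<in> F (i k)"
        using eventually_compose_filterlim[OF cofinal i_lim] s(1) less.prems by auto
      ultimately have "\<forall>\<^sub>F k in sequentially. False"
        using m
      proof eventually_elim
        case (elim k)
        have "r k \<in> E (i k)" using elim \<open>incseq E\<close> by (auto simp: incseq_def)
        moreover have "r k \<in> closure (N (i k))" using r_seq seq_closure_subset_closure by blast
        ultimately have "r k = 0" using N(3)[of "i k"] by blast
        then show False using r_seq[of k] N(4)[OF elim(2)] by simp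
      qed
      then show False by simp
    qed
  qed
  show ?thesis
  proof (intro exI[of _ M] conjI allI impI rank M0)
    show "M \<subseteq> W" using T_Y Y_V PV by (fastforce simp: M_def P_def)
    show "(closure M - {0}) \<inter> E n = {}" using clM Y_E by blast
  qed
qed

text \<open>Induction with the rank step. The sets \<open>N i\<close> have ranks above ordinals
  \<open>\<mu> i < \<gamma>\<close> that eventually dominate each
  \<open>\<delta> < \<gamma>\<close>, which treats successors and limits alike. Both
  \<open>n\<close> and \<open>W\<close> vary, because \<open>N i\<close> must avoid
  \<open>E i\<close> and fit into a prescribed neighbourhood.\<close>

lemma seq_closure_rank_unbounded:
  fixes E :: "nat \<Rightarrow> 'a::{topological_group_add, t3_space, countable} set"
  assumes E: "\<And>n. closed (E n)" "\<And>n. 0 \<in> E n" "incseq E"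
    and cover: "\<And>s. s \<longlonglongrightarrow> 0 \<Longrightarrow> \<exists>m. \<forall>\<^sub>F k in sequentially. s k \<in> E m"
    and avoid: "\<And>n. \<exists>c. c \<longlonglongrightarrow> 0 \<and> (\<forall>k. c k \<notin> E n)"
    and \<gamma>: "\<gamma> < omega1" and W: "open W" "0 \<in> W"
  shows "\<exists>M\<subseteq>W. 0 \<in> closure M \<and> (closure M - {0}) \<inter> E n = {} \<and> (\<forall>\<beta>\<le>\<gamma>. 0 \<notin> seq_closure M \<beta>)"
  using \<gamma> W
proof (induction \<gamma> arbitrary: n W rule: less_induct)
  case (less \<gamma>)
  show ?case
  proof (cases "{..<\<gamma>} = {}")
    case True
    show ?thesis
    \<comment> \<open>At the least ordinal no rank is demanded of the pieces, so \<open>{0}\<close>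
      serves as every \<open>N i\<close>.\<close>
    proof (rule seq_closure_rank_step[OF E cover avoid, where F = "\<lambda>_. {}"])
      show "\<exists>N\<subseteq>W. 0 \<in> closure N \<and> (closure N - {0}) \<inter> E i = {} \<and> (\<forall>\<beta>\<in>{}. 0 \<notin> seq_closure N \<beta>)"
        if "0 \<in> W" for W i
        using that by (intro exI[of _ "{0}"]) auto
    qed (use True less.prems in auto)
  next
    case False
    define b where "b = from_nat_into {..<\<gamma>}"
    have b: "b j < \<gamma>" for j using from_nat_into[OF False, of j] by (simp add: b_def)
    have surj: "\<exists>j. b j = \<delta>" if "\<delta> < \<gamma>" for \<delta>
      unfolding b_def by (rule from_nat_into_surj[OF countable_lessThan_omega1[OF less.prems(1)]]) (use that in simp)
    define \<mu> where "\<mu> = (\<lambda>i. Max (b ` {..i}))"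
    have \<mu>: "\<mu> i < \<gamma>" for i unfolding \<mu>_def using b by (subst Max_less_iff) auto
    show ?thesis
    proof (rule seq_closure_rank_step[OF E cover avoid, where F = "\<lambda>i. {..\<mu> i}"])
      show "\<exists>N\<subseteq>W. 0 \<in> closure N \<and> (closure N - {0}) \<inter> E i = {} \<and> (\<forall>\<beta>\<in>{..\<mu> i}. 0 \<notin> seq_closure N \<beta>)"
        if "open W" "0 \<in> W" for i W
        unfolding Ball_def atMost_iff by (rule less.IH[OF \<mu> less_trans[OF \<mu> less.prems(1)] that])
      fix \<delta> assume "\<delta> < \<gamma>"
      then obtain j where "b j = \<delta>" using surj by blast
      then have "\<delta> \<le> \<mu> i" if "i \<ge> j" for i unfolding \<mu>_def using that by (intro Max_ge) auto
      then show "\<forall>\<^sub>F i in sequentially. \<delta> \<in> {..\<mu> i}"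
        by (intro eventually_sequentiallyI[of j]) auto
    qed (use less.prems in auto)
  qed
qed

section \<open>The dichotomy for analytic topologies\<close>

definition seq_nbhd :: "'a::{zero, topological_space} set \<Rightarrow> bool"
  where "seq_nbhd D \<longleftrightarrow> (\<forall>s. s \<longlonglongrightarrow> 0 \<longrightarrow> (\<forall>\<^sub>F k in sequentially. s k \<in> D))"

text \<open>The order matters, as the group may be noncommutative: the points \<open>u\<close> and
  \<open>u + b\<close> yield \<open>b\<close>.\<close>

definition differences :: "'a::group_add set \<Rightarrow> 'a set"
  where "differences D = {- u + v |u v. u \<in> D \<and> v \<in> D}"

lemma not_seq_nbhdE:
  fixes D :: "'a::{zero, topological_space} set"
  assumes "\<not> seq_nbhd D"
  obtains b where "b \<longlonglongrightarrow> 0" "\<And>k. b k \<notin> D"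
proof -
  obtain s where s: "s \<longlonglongrightarrow> 0" "\<not> (\<forall>\<^sub>F k in sequentially. s k \<in> D)"
    using assms by (auto simp: seq_nbhd_def)
  then have "\<exists>\<^sub>F k in sequentially. s k \<notin> D" by (simp add: frequently_def)
  then have "\<forall>n. \<exists>k\<ge>n. s k \<notin> D" by (auto simp: frequently_sequentially)
  then obtain m where m: "\<And>n. m n \<ge> n" "\<And>n. s (m n) \<notin> D" by metis
  have "filterlim m at_top sequentially"
    by (rule filterlim_at_top_mono[OF filterlim_ident]) (use m(1) in auto)
  from filterlim_compose[OF s(1) this] show ?thesis using that[of "\<lambda>n. s (m n)"] m(2) by simp
qed

text \<open>
  Finite unions cost nothing: if \<open>c\<close> avoids the closed set \<open>\<Union>i<n. E i\<close> and \<open>b\<close> avoids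
  the differences of \<open>E n\<close>, then one of \<open>c k\<close> and \<open>c k + b j\<close> (\<open>j\<close> large) avoids both
  the union and \<open>E n\<close>.
\<close>

lemma avoid_finite_union:
  fixes E :: "nat \<Rightarrow> 'a::topological_group_add set"
  assumes closed_E: "\<And>i. closed (E i)"
    and b: "\<And>i. \<not> seq_nbhd (differences (E i))"
  shows "\<exists>c. c \<longlonglongrightarrow> 0 \<and> (\<forall>k. c k \<notin> (\<Union>i<n. E i))"
proof (induction n)
  case 0
  then show ?case by (intro exI[of _ "\<lambda>_. 0"]) auto
next
  case (Suc n)
  then obtain c where c: "c \<longlonglongrightarrow> 0" "\<And>k. c k \<notin> (\<Union>i<n. E i)" by blast
  obtain b where b: "b \<longlonglongrightarrow> 0" "\<And>k. b k \<notin> differences (E n)"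
    using not_seq_nbhdE[OF b] by blast
  have "\<exists>j\<ge>k. c k + b j \<notin> (\<Union>i<n. E i)" for k
  proof -
    have "open (- (\<Union>i<n. E i))" using closed_E by (intro open_Compl closed_UN) auto
    moreover have "(\<lambda>j. c k + b j) \<longlonglongrightarrow> c k + 0" by (intro tendsto_intros b(1))
    ultimately have "\<forall>\<^sub>F j in sequentially. c k + b j \<in> - (\<Union>i<n. E i)"
      using c(2)[of k] by (intro topological_tendstoD) auto
    then obtain J where "\<And>j. j \<ge> J \<Longrightarrow> c k + b j \<notin> (\<Union>i<n. E i)" by (auto simp: eventually_sequentially)
    then show ?thesis by (intro exI[of _ "max k J"]) auto
  qed
  then obtain j where j: "\<And>k. j k \<ge> k" "\<And>k. c k + b (j k) \<notin> (\<Union>i<n. E i)" by metis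
  have "filterlim j at_top sequentially"
    by (rule filterlim_at_top_mono[OF filterlim_ident]) (use j(1) in auto)
  from filterlim_compose[OF b(1) this] have bj: "(\<lambda>k. b (j k)) \<longlonglongrightarrow> 0" .
  \<comment> \<open>No correction is made where \<open>c k\<close> already avoids
    \<open>E n\<close>; the value 0 lies in every neighbourhood of 0, so convergence is
    unaffected.\<close>
  define b' where "b' = (\<lambda>k. if c k \<in> E n then b (j k) else 0)"
  have "b' \<longlonglongrightarrow> 0"
  proof (rule topological_tendstoI)
    fix S :: "'a set" assume "open S" "0 \<in> S"
    from topological_tendstoD[OF bj this] show "\<forall>\<^sub>F k in sequentially. b' k \<in> S"
      by eventually_elim (auto simp: b'_def \<open>0 \<in> S\<close>)
  qed
  from tendsto_add[OF c(1) this] have "(\<lambda>k. c k + b' k) \<longlonglongrightarrow> 0" by simp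
  moreover have "c k + b' k \<notin> (\<Union>i<Suc n. E i)" for k
  proof (cases "c k \<in> E n")
    case True
    have "c k + b (j k) \<notin> E n"
    proof
      assume "c k + b (j k) \<in> E n"
      then have "- c k + (c k + b (j k)) \<in> differences (E n)" using True unfolding differences_def by blast
      then show False using b(2) by (simp add: add.assoc[symmetric])
    qed
    then show ?thesis using True j(2)[of k] by (auto simp: b'_def less_Suc_eq)
  next
    case False
    then show ?thesis using c(2)[of k] by (auto simp: b'_def less_Suc_eq)
  qed
  ultimately show ?case by (intro exI[of _ "\<lambda>k. c k + b' k"]) blast
qed

text \<open>A countable product of discrete spaces. This makes the Baire category theorem available
  on closed sets of codes.\<close>

lemma completely_metrizable_Baire_space:
  "completely_metrizable_space (euclidean :: (nat \<Rightarrow> nat) topology)"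
proof -
  have "(euclidean :: nat topology) = discrete_topology UNIV"
    by (simp add: topology_eq open_discrete)
  then have "completely_metrizable_space (euclidean :: nat topology)"
    by (simp add: completely_metrizable_space_discrete_topology)
  then show ?thesis
    by (simp add: euclidean_product_topology[symmetric] completely_metrizable_space_product_topology)
qed

text \<open>
  Call a set of codes good if countably many large sets \<open>d\<close> (those
  for which \<open>differences (closure d)\<close> is a sequential neighbourhood of 0) refine all
  neighbourhoods of 0 coded in it. After discarding all good basic open sets, a closed set
  \<open>H\<close> of codes remains. If \<open>H\<close> is nonempty, the sets \<open>\<Inter>x\<in>B \<inter> H. Collect (f x)\<close>, for \<open>B\<close> basic
  open, are not large, but by the Baire category theorem for \<open>H\<close> every sequence converging
  to 0 eventually enters one of them.
\<close>

lemma analytic_dichotomy: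
  fixes f :: "(nat \<Rightarrow> nat) \<Rightarrow> ('a::topological_group_add \<Rightarrow> bool)"
  assumes cont: "continuous_on UNIV f" and range_f: "range f = {P. open {x. P x}}"
  shows "(\<exists>\<D>::'a set set. countable \<D> \<and> (\<forall>d\<in>\<D>. seq_nbhd (differences (closure d))) \<and>
            (\<forall>U. open U \<longrightarrow> 0 \<in> U \<longrightarrow> (\<exists>d\<in>\<D>. d \<subseteq> U))) \<or>
    (\<exists>E::nat \<Rightarrow> 'a set. (\<forall>n. closed (E n) \<and> 0 \<in> E n \<and> \<not> seq_nbhd (differences (E n))) \<and>
      (\<forall>s. s \<longlonglongrightarrow> 0 \<longrightarrow> (\<exists>m. \<forall>\<^sub>F k in sequentially. s k \<in> E m)))"
proof -
  define L where "L = (\<lambda>d::'a set. seq_nbhd (differences (closure d)))"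
  define Good where "Good = (\<lambda>K. \<exists>\<D>. countable \<D> \<and> (\<forall>d\<in>\<D>. L d) \<and>
    (\<forall>x\<in>K. f x 0 \<longrightarrow> (\<exists>d\<in>\<D>. d \<subseteq> Collect (f x))))"
  have open_f: "open (Collect (f x))" for x
    using range_f by blast
  \<comment> \<open>Evaluation at \<open>z\<close> is continuous into a discrete space. This is what
    makes \<open>H\<close>, and later each \<open>C m\<close>, closed.\<close>
  have closed_in: "closed {x. f x z}" for z
  proof -
    have "continuous_on UNIV (\<lambda>x. f x z)" by (rule continuous_on_product_then_coordinatewise[OF cont])
    then have "closed ((\<lambda>x. f x z) -` {True})" by (intro closed_vimage) (auto simp: closed_def open_discrete)
    then show ?thesis by (simp add: vimage_def)
  qed
  obtain \<B> :: "(nat \<Rightarrow> nat) set set" where \<B>: "countable \<B>" "\<And>B. B \<in> \<B> \<Longrightarrow> open B"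
    "\<And>S. open S \<Longrightarrow> \<exists>U. U \<subseteq> \<B> \<and> S = \<Union>U"
    using univ_second_countable by blast
  define H where "H = {x. f x 0} - \<Union>{B \<in> \<B>. Good B}"
  have closed_H: "closed H" unfolding H_def using closed_in \<B>(2) by (intro closed_Diff open_Union) auto
  have "\<exists>\<D>. \<forall>B\<in>{B \<in> \<B>. Good B}. countable (\<D> B) \<and> (\<forall>d\<in>\<D> B. L d) \<and>
    (\<forall>x\<in>B. f x 0 \<longrightarrow> (\<exists>d\<in>\<D> B. d \<subseteq> Collect (f x)))"
    by (rule bchoice) (auto simp: Good_def)
  then obtain \<D> where "\<forall>B\<in>{B \<in> \<B>. Good B}. countable (\<D> B) \<and> (\<forall>d\<in>\<D> B. L d) \<and>
    (\<forall>x\<in>B. f x 0 \<longrightarrow> (\<exists>d\<in>\<D> B. d \<subseteq> Collect (f x)))" ..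
  then have \<D>: "B \<in> \<B> \<Longrightarrow> Good B \<Longrightarrow> countable (\<D> B)"
    "B \<in> \<B> \<Longrightarrow> Good B \<Longrightarrow> d \<in> \<D> B \<Longrightarrow> L d"
    "B \<in> \<B> \<Longrightarrow> Good B \<Longrightarrow> x \<in> B \<Longrightarrow> f x 0 \<Longrightarrow> \<exists>d\<in>\<D> B. d \<subseteq> Collect (f x)" for B d x
    by auto
  \<comment> \<open>The union serves all good basic sets at once, hence every code outside
    \<open>H\<close> of a neighbourhood of 0.\<close>
  define \<D>' where "\<D>' = (\<Union>B\<in>{B \<in> \<B>. Good B}. \<D> B)"
  have \<D>': "countable \<D>'" "\<And>d. d \<in> \<D>' \<Longrightarrow> L d"
    using \<D>(1,2) \<B>(1) by (auto simp: \<D>'_def)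
  have outside: "\<exists>d\<in>\<D>'. d \<subseteq> Collect (f x)" if x: "f x 0" "x \<notin> H" for x
  proof -
    obtain B where B: "B \<in> \<B>" "Good B" "x \<in> B" using x by (auto simp: H_def)
    then obtain d where "d \<in> \<D> B" "d \<subseteq> Collect (f x)" using \<D>(3)[OF B x(1)] by blast
    then show ?thesis using B unfolding \<D>'_def by blast
  qed
  show ?thesis
  proof (cases "H = {}")
    case True
    have small: "\<exists>d\<in>\<D>'. d \<subseteq> U" if "open U" "0 \<in> U" for U
    proof -
      have "(\<lambda>x. x \<in> U) \<in> range f" using range_f \<open>open U\<close> by simp
      then obtain x where "f x = (\<lambda>x. x \<in> U)" by auto
      then show ?thesis using outside[of x] True \<open>0 \<in> U\<close> by auto
    qed
    have "\<forall>d\<in>\<D>'. seq_nbhd (differences (closure d))"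
      using \<D>'(2) by (simp add: L_def)
    moreover have "\<forall>U. open U \<longrightarrow> 0 \<in> U \<longrightarrow> (\<exists>d\<in>\<D>'. d \<subseteq> U)"
      using small by blast
    ultimately have "\<exists>\<D>::'a set set. countable \<D> \<and> (\<forall>d\<in>\<D>. seq_nbhd (differences (closure d))) \<and>
        (\<forall>U. open U \<longrightarrow> 0 \<in> U \<longrightarrow> (\<exists>d\<in>\<D>. d \<subseteq> U))"
      using \<D>'(1) by (intro exI[of _ \<D>'] conjI)
    then show ?thesis by (rule disjI1)
  next
    case False
    define core where "core = (\<lambda>B. \<Inter>x\<in>B \<inter> H. Collect (f x))"
    define \<A> where "\<A> = {B \<in> \<B>. B \<inter> H \<noteq> {}}"
    \<comment> \<open>If \<open>core B\<close> were large, adding it to \<open>\<D>'\<close> would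
      make \<open>B\<close> good: it lies in every set coded in \<open>B \<inter> H\<close>, and
      \<open>\<D>'\<close> handles the codes outside \<open>H\<close>. But good basic sets do not
      meet \<open>H\<close>.\<close>
    have not_L: "\<not> L (core B)" if "B \<in> \<A>" for B
    proof
      assume "L (core B)"
      then have "Good B" unfolding Good_def
        using \<D>' outside
        by (intro exI[of _ "insert (core B) \<D>'"]) (auto simp: core_def)
      then show False using that by (auto simp: H_def \<A>_def)
    qed
    have basic: "\<exists>B\<in>\<A>. B \<subseteq> S" if "open S" "S \<inter> H \<noteq> {}" for S
      using \<B>(3)[OF that(1)] that(2) unfolding \<A>_def by blast
    have countable_\<A>: "countable \<A>" using \<B>(1) by (simp add: \<A>_def)
    have \<A>_ne: "\<A> \<noteq> {}" using basic[of UNIV] False by auto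
    define E where "E = (\<lambda>n. closure (core (from_nat_into \<A> n)))"
    have in_\<A>: "from_nat_into \<A> n \<in> \<A>" for n by (rule from_nat_into[OF \<A>_ne])
    have "closed (E n) \<and> 0 \<in> E n \<and> \<not> seq_nbhd (differences (E n))" for n
    proof (intro conjI)
      have "0 \<in> core (from_nat_into \<A> n)" by (auto simp: core_def H_def)
      then show "0 \<in> E n" using closure_subset unfolding E_def by blast
      show "\<not> seq_nbhd (differences (E n))" using not_L[OF in_\<A>[of n]] by (simp add: E_def L_def)
    qed (simp add: E_def)
    moreover have "\<exists>m. \<forall>\<^sub>F k in sequentially. s k \<in> E m" if s: "s \<longlonglongrightarrow> 0" for s
    proof -
      \<comment> \<open>Each open set coded in \<open>H\<close> contains a tail of \<open>s\<close>,
        so these closed sets cover \<open>H\<close>, and by Baire category one of them has interior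
        in \<open>H\<close>. A basic \<open>B\<close> with \<open>B \<inter> H\<close> inside it has
        the tail of \<open>s\<close> in \<open>core B\<close>.\<close>
      define C where "C = (\<lambda>m. H \<inter> (\<Inter>k\<in>{m..}. {x. f x (s k)}))"
      have cover_H: "\<Union>(range C) = H"
      proof
        show "H \<subseteq> \<Union>(range C)"
        proof
          fix x assume "x \<in> H"
          then have "f x 0" by (auto simp: H_def)
          then have "\<forall>\<^sub>F k in sequentially. s k \<in> Collect (f x)"
            using topological_tendstoD[OF s open_f] by simp
          then show "x \<in> \<Union>(range C)" using \<open>x \<in> H\<close> by (auto simp: C_def eventually_sequentially)
        qed
      qed (auto simp: C_def)
      have complete: "completely_metrizable_space (top_of_set H)"
        by (intro completely_metrizable_space_closedin completely_metrizable_Baire_space)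
           (simp add: closed_H)
      have closed_C: "closedin (top_of_set H) (C m)" for m
        unfolding C_def using closed_in by (intro closedin_closed_Int closed_INT) auto
      have interior: "top_of_set H interior_of \<Union>(range C) \<noteq> {}"
        unfolding cover_H using False interior_of_topspace[of "top_of_set H"] by simp
      obtain m where "top_of_set H interior_of C m \<noteq> {}"
      proof (rule ccontr)
        assume "\<not> thesis"
        then have "top_of_set H interior_of C m = {}" for m using that by blast
        then have "top_of_set H interior_of \<Union>(range C) = {}"
          by (intro Baire_category_alt) (use complete closed_C in auto)
        then show False using interior by simp
      qed
      then obtain x T where T: "openin (top_of_set H) T" "x \<in> T" "T \<subseteq> C m"
        by (auto simp: interior_of_def)
      then obtain S where S: "open S" "T = H \<inter> S" unfolding openin_open by blast
      then have "S \<inter> H \<noteq> {}" using T(2) by blast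
      then obtain B where "B \<in> \<A>" "B \<subseteq> S" using basic[OF S(1)] by blast
      then have B: "B \<in> \<A>" "B \<inter> H \<subseteq> C m" using S(2) T(3) by blast+
      obtain i where i: "from_nat_into \<A> i = B" using from_nat_into_surj[OF countable_\<A> B(1)] by blast
      have "s k \<in> E i" if "k \<ge> m" for k
      proof -
        have "s k \<in> core B" using B(2) that by (auto simp: core_def C_def)
        then show ?thesis using closure_subset i unfolding E_def by blast
      qed
      then show ?thesis by (auto simp: eventually_sequentially)
    qed
    ultimately show ?thesis by blast
  qed
qed

section \<open>Countable bases\<close>

definition countable_base :: "'a::topological_space set set \<Rightarrow> bool"
  where "countable_base \<V> \<longleftrightarrow> countable \<V> \<and> (\<forall>V\<in>\<V>. open V) \<and>
    (\<forall>U x. open U \<longrightarrow> x \<in> U \<longrightarrow> (\<exists>V\<in>\<V>. x \<in> V \<and> V \<subseteq> U))"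

text \<open>The \<open>n\<close>-th term is chosen in the intersection of the first
  \<open>n + 1\<close> listed basic sets containing \<open>x\<close>. This yields both sequentiality
  and the bound on the sequential order.\<close>

lemma closure_subset_seq_limits:
  assumes "countable_base (\<V> :: 'a::topological_space set set)"
  shows "closure A \<subseteq> seq_limits (A :: 'a set)"
proof
  fix x assume x: "x \<in> closure A"
  have \<V>: "countable \<V>" "\<And>V. V \<in> \<V> \<Longrightarrow> open V"
    "\<And>U x. open U \<Longrightarrow> x \<in> U \<Longrightarrow> \<exists>V\<in>\<V>. x \<in> V \<and> V \<subseteq> U"
    using assms by (auto simp: countable_base_def)
  define \<X> where "\<X> = {V \<in> \<V>. x \<in> V}"
  have ne: "\<X> \<noteq> {}" using \<V>(3)[of UNIV x] by (auto simp: \<X>_def)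
  have co: "countable \<X>" using \<V>(1) by (simp add: \<X>_def)
  define U where "U = (\<lambda>n. \<Inter>i\<in>{..n::nat}. from_nat_into \<X> i)"
  have inX: "from_nat_into \<X> i \<in> \<X>" for i by (rule from_nat_into[OF ne])
  have "open (U n)" "x \<in> U n" for n
    unfolding U_def using inX \<V>(2) by (auto intro!: open_INT simp: \<X>_def)
  then have "U n \<inter> A \<noteq> {}" for n
    using x by (meson IntI disjoint_iff open_Int_closure_eq_empty)
  then have "\<forall>n. \<exists>y. y \<in> A \<and> y \<in> U n" by blast
  then obtain s where s: "\<And>n. s n \<in> A" "\<And>n. s n \<in> U n" by metis
  have "s \<longlonglongrightarrow> x"
  proof (rule topological_tendstoI)
    fix S assume "open S" "x \<in> S"
    then obtain V where "V \<in> \<X>" "V \<subseteq> S" using \<V>(3)[of S x] unfolding \<X>_def by blast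
    then obtain i where "from_nat_into \<X> i \<subseteq> S" using from_nat_into_surj[OF co] by metis
    then have "s n \<in> S" if "n \<ge> i" for n using s(2)[of n] that by (auto simp: U_def)
    then show "\<forall>\<^sub>F n in sequentially. s n \<in> S" by (auto simp: eventually_sequentially)
  qed
  with s(1) show "x \<in> seq_limits A" by (rule seq_limitsI)
qed

lemma sequential_spaceI:
  assumes "\<And>A::'a::topological_space set. closure A \<subseteq> seq_limits A"
  shows "sequential_space TYPE('a)"
  unfolding sequential_space_def
proof (intro allI impI)
  fix A :: "'a set" assume "closure A - A \<noteq> {}"
  then obtain x where x: "x \<in> closure A - A" by blast
  then have "x \<in> seq_limits A" using assms by blast
  then show "\<exists>s. \<exists>x\<in>closure A - A. (\<forall>n. s n \<in> A) \<and> s \<longlonglongrightarrow> x"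
    using x unfolding seq_limits_def by blast
qed

lemma metrizable_imp_countable_base:
  assumes "metrizable_space (euclidean :: 'a::{topological_space, countable} topology)"
  shows "\<exists>\<V>::'a set set. countable_base \<V>"
proof -
  have "\<forall>x. \<exists>\<B>::'a set set. countable \<B> \<and> (\<forall>V\<in>\<B>. open V) \<and>
      (\<forall>U. open U \<and> x \<in> U \<longrightarrow> (\<exists>V\<in>\<B>. x \<in> V \<and> V \<subseteq> U))"
    using metrizable_imp_first_countable[OF assms] by (simp add: first_countable_def)
  from choice[OF this] obtain \<B> :: "'a \<Rightarrow> 'a set set"
    where "\<forall>x. countable (\<B> x) \<and> (\<forall>V\<in>\<B> x. open V) \<and>
      (\<forall>U. open U \<and> x \<in> U \<longrightarrow> (\<exists>V\<in>\<B> x. x \<in> V \<and> V \<subseteq> U))" ..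
  then have \<B>: "countable (\<B> x)" "V \<in> \<B> x \<Longrightarrow> open V"
    "open U \<Longrightarrow> x \<in> U \<Longrightarrow> \<exists>V\<in>\<B> x. x \<in> V \<and> V \<subseteq> U" for x U V
    by auto
  have "countable_base (\<Union>x. \<B> x)"
    unfolding countable_base_def
  proof (intro conjI allI impI)
    show "countable (\<Union>x. \<B> x)" by (intro countable_UN \<B>(1)) simp
    show "\<forall>V\<in>\<Union>x. \<B> x. open V" using \<B>(2) by blast
    fix U :: "'a set" and x assume "open U" "x \<in> U"
    then obtain V where "V \<in> \<B> x" "x \<in> V \<and> V \<subseteq> U" using \<B>(3) by blast
    then show "\<exists>V\<in>\<Union>x. \<B> x. x \<in> V \<and> V \<subseteq> U" by blast
  qed
  then show ?thesis by blast
qed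

text \<open>Urysohn metrization: a countable regular space is Lindelof, hence normal, and Urysohn
  functions indexed by a point and a basic set embed it into a countable power of the reals.\<close>

lemma metrizable_if_countable_base:
  assumes "countable_base (\<V> :: 'a::{t3_space, countable} set set)"
  shows "metrizable_space (euclidean :: 'a topology)"
proof -
  have "regular_space (euclidean :: 'a topology)"
    unfolding regular_space_def disjnt_def using t3_space by (fastforce simp: Ball_def)
  moreover have "Lindelof_space (euclidean :: 'a topology)"
    by (rule countable_imp_Lindelof_space) simp
  ultimately have normal: "normal_space (euclidean :: 'a topology)"
    by (rule regular_Lindelof_imp_normal_space)
  have \<V>: "countable \<V>" "\<And>V. V \<in> \<V> \<Longrightarrow> open V"
    "\<And>U x. open U \<Longrightarrow> x \<in> U \<Longrightarrow> \<exists>V\<in>\<V>. x \<in> V \<and> V \<subseteq> U"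
    using assms by (auto simp: countable_base_def)
  have "\<V> \<noteq> {}" using \<V>(3)[of UNIV] by auto
  define V where "V = from_nat_into \<V>"
  have V: "range V = \<V>" unfolding V_def by (rule range_from_nat_into[OF \<open>\<V> \<noteq> {}\<close> \<V>(1)])
  \<comment> \<open>For a pair whose point lies outside the basic set, only continuity is demanded
    and a constant function suffices.\<close>
  have "\<forall>p. \<exists>h::'a \<Rightarrow> real. continuous_on UNIV h \<and>
      (fst p \<in> V (snd p) \<longrightarrow> h (fst p) = 1 \<and> (\<forall>z. z \<notin> V (snd p) \<longrightarrow> h z = 0))"
  proof
    fix p :: "'a \<times> nat"
    show "\<exists>h::'a \<Rightarrow> real. continuous_on UNIV h \<and>
      (fst p \<in> V (snd p) \<longrightarrow> h (fst p) = 1 \<and> (\<forall>z. z \<notin> V (snd p) \<longrightarrow> h z = 0))"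
    proof (cases "fst p \<in> V (snd p)")
      case True
      have "open (V (snd p))" using \<V>(2) V by blast
      then have "closedin euclidean (- V (snd p))" by (simp add: closed_Compl)
      moreover have "closedin euclidean {fst p}" by simp
      moreover have "disjnt {fst p} (- V (snd p))" using True by (simp add: disjnt_def)
      ultimately obtain h where "continuous_map euclidean euclideanreal h" "h ` {fst p} \<subseteq> {1}"
        "h ` (- V (snd p)) \<subseteq> {0}"
        using Urysohn_lemma_alt[OF normal] by metis
      then show ?thesis by (intro exI[of _ h]) auto
    next
      case False
      then show ?thesis by (intro exI[of _ "\<lambda>_. 0"]) auto
    qed
  qed
  from choice[OF this] obtain h :: "'a \<times> nat \<Rightarrow> 'a \<Rightarrow> real"
    where h_all: "\<forall>p. continuous_on UNIV (h p) \<and>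
      (fst p \<in> V (snd p) \<longrightarrow> h p (fst p) = 1 \<and> (\<forall>z. z \<notin> V (snd p) \<longrightarrow> h p z = 0))" ..
  have h: "continuous_on UNIV (h p)" "x \<in> V n \<Longrightarrow> h (x, n) x = 1"
    "x \<in> V n \<Longrightarrow> z \<notin> V n \<Longrightarrow> h (x, n) z = 0" for p x n z
    using h_all[rule_format, of p] h_all[rule_format, of "(x, n)"] by simp_all
  define e where "e = (\<lambda>z p. h p z)"
  have "continuous_on UNIV e"
    unfolding e_def by (intro continuous_on_coordinatewise_then_product h(1))
  then have "continuous_map euclidean (top_of_set (range e)) e"
    by (simp add: continuous_map_in_subtopology)
  moreover have "open_map euclidean (top_of_set (range e)) e"
    unfolding open_map_def
  proof (intro allI impI)
    fix U :: "'a set" assume "openin euclidean U"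
    then have "open U" by simp
    show "openin (top_of_set (range e)) (e ` U)"
    proof (subst openin_subopen, intro ballI)
      fix q assume "q \<in> e ` U"
      then obtain y where y: "y \<in> U" "q = e y" by blast
      then obtain n where n: "y \<in> V n" "V n \<subseteq> U" using \<V>(3)[OF \<open>open U\<close>] V by blast
      \<comment> \<open>Positivity at the coordinate \<open>(y, n)\<close> puts a point into
        \<open>V n\<close>, hence into \<open>U\<close>.\<close>
      define T where "T = {\<phi>::'a \<times> nat \<Rightarrow> real. \<phi> (y, n) > 0}"
      have "open T" unfolding T_def
        by (intro open_Collect_less continuous_on_product_coordinates continuous_on_const)
      have "range e \<inter> T \<subseteq> e ` U"
        using h(3)[OF n(1)] n(2) by (fastforce simp: T_def e_def)
      moreover have "q \<in> range e \<inter> T" using y(2) h(2)[OF n(1)] by (auto simp: T_def e_def)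
      ultimately show "\<exists>T. openin (top_of_set (range e)) T \<and> q \<in> T \<and> T \<subseteq> e ` U"
        using \<open>open T\<close> by (meson openin_open_Int)
    qed
  qed
  moreover have "inj e"
  proof (rule injI, rule ccontr)
    fix x y assume "e x = e y" "x \<noteq> y"
    then obtain n where n: "x \<in> V n" "y \<notin> V n" using \<V>(3)[of "- {y}" x] V by auto
    then have "e x (x, n) = 1" "e y (x, n) = 0" using h by (auto simp: e_def)
    then show False using \<open>e x = e y\<close> by simp
  qed
  ultimately have "homeomorphic_map euclidean (top_of_set (range e)) e"
    by (intro bijective_open_imp_homeomorphic_map) auto
  then have "(euclidean :: 'a topology) homeomorphic_space (top_of_set (range e))"
    by (rule homeomorphic_map_imp_homeomorphic_space)
  then show ?thesis
    using homeomorphic_metrizable_space metrizable_space_subtopology metrizable_space_euclidean by blast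
qed

section \<open>Open sets coded by sequences of natural numbers\<close>

text \<open>
  The open set coded by \<open>g\<close>: at stage \<open>n\<close> the \<open>n\<close>-th point is either already covered, or it gets
  covered by \<open>V (g n)\<close> provided that this set contains no point excluded earlier, or it is
  excluded for good. Membership of the \<open>n\<close>-th point depends only on \<open>g 0, \<dots>, g n\<close>.
\<close>

fun stage :: "(nat \<Rightarrow> 'a::countable set) \<Rightarrow> (nat \<Rightarrow> nat) \<Rightarrow> nat \<Rightarrow> 'a set \<times> 'a set" where
  "stage V g 0 = ({}, {})"
| "stage V g (Suc n) = (case stage V g n of (C, X) \<Rightarrow>
    if from_nat n \<in> C then (C, X)
    else if from_nat n \<in> V (g n) \<and> V (g n) \<inter> X = {} then (C \<union> V (g n), X)
    else (C, insert (from_nat n) X))"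

lemma stage_cong: "(\<And>i. i < n \<Longrightarrow> g i = g' i) \<Longrightarrow> stage V g n = stage V g' n"
proof (induction n)
  case (Suc n)
  then have eq: "stage V g n = stage V g' n" "g n = g' n" by auto
  show ?case unfolding stage.simps eq by (rule refl)
qed simp

lemma stage_disjoint: "fst (stage V g n) \<inter> snd (stage V g n) = {}"
  by (induction n) (auto split: prod.splits)

lemma stage_mono:
  assumes "m \<le> n"
  shows "fst (stage V g m) \<subseteq> fst (stage V g n)" and "snd (stage V g m) \<subseteq> snd (stage V g n)"
  using assms by (induction n rule: dec_induct) (auto split: prod.splits)

lemma stage_decides: "from_nat n \<in> fst (stage V g (Suc n)) \<union> snd (stage V g (Suc n))"
  by (auto split: prod.splits)

text \<open>By stage \<open>Suc (to_nat z)\<close> the point \<open>z\<close> is either covered or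
  excluded, and an excluded point is never covered later. So membership depends on a finite part of
  \<open>g\<close>.\<close>

lemma stage_limit_iff:
  "z \<in> (\<Union>n. fst (stage V g n)) \<longleftrightarrow> z \<in> fst (stage V g (Suc (to_nat z)))"
proof
  assume "z \<in> (\<Union>n. fst (stage V g n))"
  then obtain n where n: "z \<in> fst (stage V g n)" by blast
  let ?m = "Suc (to_nat z)"
  have "z \<in> fst (stage V g (max n ?m))" using n stage_mono(1)[of n "max n ?m"] by auto
  then have "z \<notin> snd (stage V g (max n ?m))" using stage_disjoint by blast
  then have "z \<notin> snd (stage V g ?m)" using stage_mono(2)[of ?m "max n ?m" V g] by auto
  then show "z \<in> fst (stage V g ?m)" using stage_decides[of "to_nat z" V g] by auto
qed blast

text \<open>Finite dependence makes the coding continuous. To reach an open \<open>P\<close>, let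
  \<open>g n\<close> select a basic set inside \<open>P\<close> around the \<open>n\<close>-th point
  or, if that point is outside \<open>P\<close>, the empty set.\<close>

lemma analytic_if_countable_base:
  assumes "countable_base (\<V> :: 'a::{topological_space, countable} set set)"
  shows "analytic_topology TYPE('a)"
proof -
  have \<V>: "countable \<V>" "\<And>V. V \<in> \<V> \<Longrightarrow> open V"
    "\<And>U x. open U \<Longrightarrow> x \<in> U \<Longrightarrow> \<exists>V\<in>\<V>. x \<in> V \<and> V \<subseteq> U"
    using assms by (auto simp: countable_base_def)
  \<comment> \<open>The added empty set supplies the index that excludes a point not yet
    covered.\<close>
  define V where "V = from_nat_into (insert {} \<V>)"
  have V: "range V = insert {} \<V>"
    unfolding V_def using \<V>(1) by (intro range_from_nat_into) auto
  have open_V: "open (V k)" for k using V \<V>(2) by (metis insertE open_empty rangeI)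
  obtain k\<^sub>0 where k\<^sub>0: "V k\<^sub>0 = {}" using V by (metis insertI1 rangeE)
  define f where "f = (\<lambda>g z. z \<in> (\<Union>n. fst (stage V g n)))"
  have "continuous_on UNIV f"
  proof (rule continuous_on_coordinatewise_then_product)
    fix z :: 'a
    define m where "m = Suc (to_nat z)"
    have "open ((\<lambda>g. f g z) -` B)" for B
    proof (subst open_subopen, intro ballI)
      fix g assume g: "g \<in> (\<lambda>g. f g z) -` B"
      define T where "T = (\<Inter>i\<in>{..<m}. (\<lambda>g'. g' i) -` {g i})"
      have "open T" unfolding T_def
        by (intro open_INT ballI open_vimage continuous_on_product_coordinates) (auto simp: open_discrete)
      moreover have "g \<in> T" by (simp add: T_def)
      moreover have "T \<subseteq> (\<lambda>g. f g z) -` B"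
      proof
        fix g' assume "g' \<in> T"
        then have "stage V g' m = stage V g m" by (intro stage_cong) (simp add: T_def)
        then have "f g' z = f g z" unfolding f_def stage_limit_iff m_def by simp
        then show "g' \<in> (\<lambda>g. f g z) -` B" using g by simp
      qed
      ultimately show "\<exists>T. open T \<and> g \<in> T \<and> T \<subseteq> (\<lambda>g. f g z) -` B" by blast
    qed
    then show "continuous_on UNIV (\<lambda>g. f g z)" by (simp add: continuous_on_open_vimage)
  qed
  moreover have "range f = {P. open {x. P x}}"
  proof (intro equalityI subsetI)
    fix P assume "P \<in> range f"
    then obtain g where g: "P = f g" by blast
    have "open (fst (stage V g n))" for n
      by (induction n) (auto split: prod.splits intro: open_Un open_V)
    then have "open (\<Union>n. fst (stage V g n))" by blast
    moreover have "{x. P x} = (\<Union>n. fst (stage V g n))" by (simp only: g f_def Collect_mem_eq)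
    ultimately show "P \<in> {P. open {x. P x}}" by simp
  next
    fix P :: "'a \<Rightarrow> bool" assume "P \<in> {P. open {x. P x}}"
    then have P: "open {x. P x}" by simp
    have "\<exists>k. (if P (from_nat n) then from_nat n \<in> V k \<and> V k \<subseteq> {x. P x} else V k = {})" for n
    proof (cases "P (from_nat n)")
      case True
      then obtain W where "W \<in> \<V>" "from_nat n \<in> W" "W \<subseteq> {x. P x}" using \<V>(3)[OF P] by auto
      moreover have "W \<in> range V" using \<open>W \<in> \<V>\<close> V by blast
      ultimately show ?thesis using True by auto
    qed (use k\<^sub>0 in auto)
    then obtain g where g: "\<And>n. if P (from_nat n) then from_nat n \<in> V (g n) \<and> V (g n) \<subseteq> {x. P x} else V (g n) = {}"
      by metis
    have inv: "fst (stage V g n) \<subseteq> {x. P x} \<and> snd (stage V g n) \<inter> {x. P x} = {}" for n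
    proof (induction n)
      case (Suc n)
      then show ?case using g[of n] by (auto split: prod.splits if_splits)
    qed simp
    have "f g = P"
    proof
      fix z
      have "z \<in> fst (stage V g (Suc (to_nat z)))" if "P z"
        using inv[of "Suc (to_nat z)"] stage_decides[of "to_nat z" V g] that by auto
      moreover have "P z" if "z \<in> fst (stage V g (Suc (to_nat z)))"
        using inv[of "Suc (to_nat z)"] that by auto
      ultimately show "f g z = P z" unfolding f_def stage_limit_iff by blast
    qed
    then show "P \<in> range f" by blast
  qed
  ultimately show ?thesis unfolding analytic_topology_def by blast
qed

section \<open>From sequential neighbourhoods of 0 to a countable base\<close>

lemma seq_nbhd_finite_Int:
  assumes "finite I" "\<And>i. i \<in> I \<Longrightarrow> seq_nbhd (D i)"
  shows "seq_nbhd (\<Inter>i\<in>I. D i)"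
  using assms by (auto simp: seq_nbhd_def eventually_ball_finite_distrib)

text \<open>
  A sequential group with countably many sequential neighbourhoods of 0 refining all
  neighbourhoods of 0 is Frechet: if \<open>x n\<close> converges to \<open>x\<close> and each \<open>x n\<close> is the limit of a
  sequence in \<open>A\<close>, choose \<open>a n\<close> in the \<open>n\<close>-th sequence with \<open>- x n + a n \<in> D n\<close>.
\<close>

lemma countable_base_if_weak_base:
  fixes \<D> :: "'a::{topological_group_add, countable} set set"
  assumes seq: "sequential_space TYPE('a)" and "countable \<D>"
    and nbhd: "\<And>d. d \<in> \<D> \<Longrightarrow> seq_nbhd d"
    and small: "\<And>U. open U \<Longrightarrow> 0 \<in> U \<Longrightarrow> \<exists>d\<in>\<D>. d \<subseteq> U"
  shows "\<exists>\<V>::'a set set. countable_base \<V>"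
proof -
  have ne: "\<D> \<noteq> {}" using small[of UNIV] by auto
  define D where "D = (\<lambda>n. \<Inter>i\<in>{..n::nat}. from_nat_into \<D> i)"
  have D_nbhd: "seq_nbhd (D n)" for n
    unfolding D_def by (rule seq_nbhd_finite_Int) (use nbhd from_nat_into[OF ne] in auto)
  have D_small: "\<exists>n. \<forall>m\<ge>n. D m \<subseteq> U" if U: "open U" "0 \<in> U" for U
  proof -
    obtain i where "from_nat_into \<D> i \<subseteq> U"
      using small[OF U] from_nat_into_surj[OF \<open>countable \<D>\<close>] by metis
    then show ?thesis by (intro exI[of _ i]) (auto simp: D_def)
  qed
  have idem: "seq_limits (seq_limits A) \<subseteq> seq_limits A" for A :: "'a set"
  proof
    fix x assume "x \<in> seq_limits (seq_limits A)"
    then obtain u where u: "\<And>n. u n \<in> seq_limits A" "u \<longlonglongrightarrow> x" by (auto simp: seq_limits_def)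
    have "\<exists>a\<in>A. - u n + a \<in> D n" for n
    proof -
      obtain s where s: "\<And>k. s k \<in> A" "s \<longlonglongrightarrow> u n" using u(1)[of n] by (auto simp: seq_limits_def)
      have "(\<lambda>k. - u n + s k) \<longlonglongrightarrow> - u n + u n" by (intro tendsto_intros s(2))
      then have "\<forall>\<^sub>F k in sequentially. - u n + s k \<in> D n" using D_nbhd by (simp add: seq_nbhd_def)
      then obtain k where "- u n + s k \<in> D n" using eventually_happens'[OF sequentially_bot] by blast
      then show ?thesis using s(1) by blast
    qed
    then obtain a where a: "\<And>n. a n \<in> A" "\<And>n. - u n + a n \<in> D n" by metis
    have "(\<lambda>n. - u n + a n) \<longlonglongrightarrow> 0"
    proof (rule topological_tendstoI)
      fix S :: "'a set" assume "open S" "0 \<in> S"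
      then obtain n where "\<And>m. m \<ge> n \<Longrightarrow> D m \<subseteq> S" using D_small by blast
      then show "\<forall>\<^sub>F n in sequentially. - u n + a n \<in> S"
        using a(2) by (auto simp: eventually_sequentially)
    qed
    from tendsto_add[OF u(2) this] have "a \<longlonglongrightarrow> x" by (simp add: add.assoc[symmetric])
    with a(1) show "x \<in> seq_limits A" by (rule seq_limitsI)
  qed
  have frechet: "closure A \<subseteq> seq_limits A" for A :: "'a set"
    using sequential_space_closedI[OF seq idem, of A] seq_limits_increasing by (rule closure_minimal[rotated])
  \<comment> \<open>\<open>D n\<close> may fail to be open, so its interior
    \<open>- closure (- D n)\<close> is translated. The interior contains 0, since otherwise the
    Frechet property would give a sequence outside \<open>D n\<close> converging to 0.\<close>
  define V where "V = (\<lambda>x n. {z. - x + z \<in> - closure (- D n)})"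
  have zero: "0 \<in> - closure (- D n)" for n
  proof
    assume "0 \<in> closure (- D n)"
    then have "0 \<in> seq_limits (- D n)" using frechet by blast
    then obtain s where s: "\<And>k. s k \<in> - D n" "s \<longlonglongrightarrow> 0" unfolding seq_limits_def by blast
    have "\<forall>\<^sub>F k in sequentially. s k \<in> D n"
      using D_nbhd s(2) unfolding seq_nbhd_def by blast
    then show False using s(1) eventually_happens'[OF sequentially_bot] by blast
  qed
  have open_Vx: "open (V x n)" for x n
    unfolding V_def by (intro open_left_translation_vimage open_Compl closed_closure)
  have "countable_base (range (\<lambda>(x, n). V x n))"
    unfolding countable_base_def
  proof (intro conjI allI impI)
    show "\<forall>W\<in>range (\<lambda>(x, n). V x n). open W"
      using open_Vx by auto
    fix U :: "'a set" and x assume "open U" "x \<in> U"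
    then have "open {z. x + z \<in> U}" "0 \<in> {z. x + z \<in> U}" by (auto intro: open_left_translation_vimage)
    from D_small[OF this] obtain n where n: "D n \<subseteq> {z. x + z \<in> U}" by blast
    have "V x n \<subseteq> U"
    proof
      fix z assume "z \<in> V x n"
      then have "- x + z \<in> D n" using closure_subset[of "- D n"] by (auto simp: V_def)
      then have "x + (- x + z) \<in> U" using n by blast
      then show "z \<in> U" by (simp add: add.assoc[symmetric])
    qed
    moreover have "x \<in> V x n" using zero[of n] by (simp add: V_def)
    ultimately show "\<exists>W\<in>range (\<lambda>(x, n). V x n). x \<in> W \<and> W \<subseteq> U" by blast
  qed auto
  then show ?thesis by blast
qed

text \<open>Continuity of \<open>- u + v\<close> at the origin, followed by regularity to allow
  closures. This transfers smallness of \<open>d\<close> to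
  \<open>differences (closure d)\<close>.\<close>

lemma differences_closure_small:
  fixes U :: "'a::{topological_group_add, t3_space} set"
  assumes "open U" "0 \<in> U"
  obtains V where "open V" "0 \<in> V" "differences (closure V) \<subseteq> U"
proof -
  define S where "S = (\<lambda>p::'a \<times> 'a. - fst p + snd p) -` U"
  have "open S" "(0, 0) \<in> S"
    unfolding S_def using assms by (auto intro!: open_vimage continuous_intros)
  then obtain A B where AB: "open A" "open B" "0 \<in> A" "0 \<in> B" "A \<times> B \<subseteq> S"
    by (auto elim!: open_prod_elim)
  then have "open (A \<inter> B)" "0 \<in> A \<inter> B" by auto
  then obtain V where V: "open V" "0 \<in> V" "closure V \<subseteq> A \<inter> B" by (rule t3_closed_nhd)
  have "differences (closure V) \<subseteq> U"
    unfolding differences_def using V(3) AB(5) by (force simp: S_def)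
  with V(1,2) show ?thesis by (rule that)
qed

section \<open>The characterization\<close>

theorem corollary1:
  shows "metrizable_space (euclidean :: 'a::{topological_group_add, t3_space, countable} topology)
    \<longleftrightarrow> sequential_space TYPE('a) \<and> analytic_topology TYPE('a)
        \<and> sequential_order TYPE('a) < omega1"
proof
  assume "metrizable_space (euclidean :: 'a topology)"
  then obtain \<V> :: "'a set set" where "countable_base \<V>" using metrizable_imp_countable_base by blast
  then show "sequential_space TYPE('a) \<and> analytic_topology TYPE('a) \<and> sequential_order TYPE('a) < omega1"
    using closure_subset_seq_limits analytic_if_countable_base
    by (intro conjI sequential_spaceI sequential_order_less_omega1I)
next
  assume asm: "sequential_space TYPE('a) \<and> analytic_topology TYPE('a) \<and> sequential_order TYPE('a) < omega1"
  then obtain f :: "(nat \<Rightarrow> nat) \<Rightarrow> ('a \<Rightarrow> bool)"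
    where f: "continuous_on UNIV f" "range f = {P. open {x. P x}}"
    unfolding analytic_topology_def by blast
  from analytic_dichotomy[OF f] show "metrizable_space (euclidean :: 'a topology)"
  proof (elim disjE exE conjE)
    fix \<D> :: "'a set set"
    assume \<D>: "countable \<D>" "\<forall>d\<in>\<D>. seq_nbhd (differences (closure d))"
      "\<forall>U. open U \<longrightarrow> 0 \<in> U \<longrightarrow> (\<exists>d\<in>\<D>. d \<subseteq> U)"
    have "\<exists>\<V>::'a set set. countable_base \<V>"
    proof (rule countable_base_if_weak_base[where \<D> = "(\<lambda>d. differences (closure d)) ` \<D>"])
      fix U :: "'a set" assume "open U" "0 \<in> U"
      then obtain V where V: "open V" "0 \<in> V" "differences (closure V) \<subseteq> U"
        by (rule differences_closure_small)
      obtain d where d: "d \<in> \<D>" "d \<subseteq> V" using \<D>(3) V(1,2) by blast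
      have "differences (closure d) \<subseteq> differences (closure V)"
        using closure_mono[OF d(2)] unfolding differences_def by blast
      then show "\<exists>d\<in>(\<lambda>d. differences (closure d)) ` \<D>. d \<subseteq> U" using V(3) d(1) by blast
    qed (use asm \<D> in auto)
    then show ?thesis using metrizable_if_countable_base by blast
  next
    fix E :: "nat \<Rightarrow> 'a set"
    assume E: "\<forall>n. closed (E n) \<and> 0 \<in> E n \<and> \<not> seq_nbhd (differences (E n))"
      and cover: "\<forall>s. s \<longlonglongrightarrow> 0 \<longrightarrow> (\<exists>m. \<forall>\<^sub>F k in sequentially. s k \<in> E m)"
    \<comment> \<open>Finite unions make the sets increasing, and \<open>avoid_finite_union\<close>
      provides the sequences avoiding them. The bound \<open>Suc n\<close> puts \<open>E 0\<close>
      into each union, so each contains 0.\<close>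
    define E' where "E' = (\<lambda>n. \<Union>i<Suc n. E i)"
    let ?\<gamma> = "sequential_order TYPE('a)"
    \<comment> \<open>With \<open>\<gamma>\<close> the sequential order itself, such an
      \<open>M\<close> contradicts that this stage is the whole closure.\<close>
    have "\<exists>M\<subseteq>UNIV. 0 \<in> closure M \<and> (closure M - {0}) \<inter> E' 0 = {} \<and> (\<forall>\<beta>\<le>?\<gamma>. 0 \<notin> seq_closure M \<beta>)"
    proof (rule seq_closure_rank_unbounded)
      show "closed (E' n)" for n unfolding E'_def using E by (intro closed_UN) auto
      show "0 \<in> E' n" for n using E by (auto simp: E'_def)
      show "incseq E'" by (rule incseq_SucI) (auto simp: E'_def less_Suc_eq)
      show "\<exists>c. c \<longlonglongrightarrow> 0 \<and> (\<forall>k. c k \<notin> E' n)" for n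
        unfolding E'_def using E by (intro avoid_finite_union) auto
      show "\<exists>m. \<forall>\<^sub>F k in sequentially. s k \<in> E' m" if s: "s \<longlonglongrightarrow> 0" for s
      proof -
        obtain m where m: "\<forall>\<^sub>F k in sequentially. s k \<in> E m" using cover[rule_format, OF s] ..
        then have "\<forall>\<^sub>F k in sequentially. s k \<in> E' m"
          by (rule eventually_mono) (auto simp: E'_def)
        then show ?thesis ..
      qed
    qed (use asm in auto)
    then obtain M :: "'a set" where "0 \<in> closure M" "0 \<notin> seq_closure M ?\<gamma>" by blast
    then show ?thesis using closure_eq_seq_closure_sequential_order asm by blast
  qed
qed

end
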